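(* Let $\mathcal X$ be a Polish space with Borel $\sigma$-algebra and $\sigma$-finite reference measure $\mathrm dx$; let $\pi,\pi_Y$ be probability measures with densities (also denoted $\pi,\pi_Y$) and $w=\pi/\pi_Y$ with $|w|_\infty<\infty$. Fix $\epsilon\in(0,1)$ and a Markov kernel $P$ on $\mathcal X$ with stationary distribution $\pi$. Let $\{(X_n,Y_n)\}_{n\ge0}$ be generated by the Importance Resampling MCMC algorithm: $X_0=x_0$, $Y_0=y_0$; with $\mathcal F_n=\sigma(X_0,\dots,X_n,Y_0,\dots,Y_n)$, the auxiliary process satisfies $\mathbb E(h(Y_{n+1})\mid\mathcal F_n)=\mathbb E(h(Y_{n+1})\mid Y_0,\dots,Y_n)$ for bounded measurable $h$ (otherwise its dynamics are arbitrary); given $\mathcal F_{n-1}$, $X_n$ and $Y_n$ are conditionally independent, and $X_n$ is drawn from $P(X_{n-1},\cdot)$ with probability $1-\epsilon$ and from $\hat\theta_{n-1}$ with probability $\epsilon$, where the choice is made by i.i.d. Bernoulli($\epsilon$) variables $Z_n$ independent of $\{Y_k\}$ and of $\mathcal F_{n-1}$, and \[ \hat\theta_n=\sum_{i=1}^n\frac{w(Y_i)}{\sum_{j=1}^nw(Y_j)}\delta_{Y_i}\ (n\ge1),\qquad \hat\theta_0=\delta_{y_0}. \] Define for $n\ge1$ \[ B_n=|w|_\infty\sup_{|f|\le1}\mathbb E\,\hat\pi_{Y,n}(\bar f)+2|w|_\infty^2\sup_{|f|\le1}\mathbb E\big(\hat\pi_{Y,n}(\bar f)\big)^2, \] and $B_0=B_{-1}=1$.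 Then for all $n$, \[ \|\mathcal L_{X_n}-\pi\|_{TV}\le\sum_{\ell=0}^n(1-\epsilon)^{n-\ell}B_{\ell-1}, \] and for every bounded measurable $f$ and $n\in\mathbb N$, \[ \mathbb E\Big[\frac1{\sqrt n}\sum_{i=1}^n(f(X_i)-\pi(f))\Big]^2\le\frac{80\epsilon^{-2}|f|_\infty^2}{n}+64\epsilon^{-2}|f|_\infty^2+|f|_\infty^2\Big(\frac1{\sqrt n}\sum_{k=0}^{n-1}\sqrt{B_k}\Big)^2 . \]
   Context: $\hat\pi_{Y,n}=\frac1n\sum_{i=1}^n\delta_{Y_i}$ and $\hat\pi_{Y,n}(\bar f)=\hat\pi_{Y,n}(f)-\pi_Y(f)$; suprema are over measurable $f$ with $|f|\le1$. $\mathcal L_{X_n}$ denotes the law of $X_n$ and $\|\mu-\nu\|_{TV}=\frac12\sup_{|f|\le1}|\mu(f)-\nu(f)|$. $|f|_\infty=\sup_x|f(x)|$. *)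

theory Defs
  imports "HOL-Analysis.Analysis" "HOL-Probability.Probability"
begin

definition supnorm :: "('a \<Rightarrow> real) \<Rightarrow> real" where
  "supnorm f = (SUP x. \<bar>f x\<bar>)"

definition bdd1 :: "('a::topological_space \<Rightarrow> real) set" where
  "bdd1 = {f. f \<in> borel_measurable borel \<and> (\<forall>x. \<bar>f x\<bar> \<le> 1)}"

definition tv_dist :: "'a::topological_space measure \<Rightarrow> 'a measure \<Rightarrow> real" where
  "tv_dist \<mu> \<nu> = 1/2 * (SUP f\<in>bdd1. \<bar>(\<integral>x. f x \<partial>\<mu>) - (\<integral>x. f x \<partial>\<nu>)\<bar>)"

definition events_of :: "'w measure \<Rightarrow> 'b measure \<Rightarrow> ('w \<Rightarrow> 'b) \<Rightarrow> 'w set set" where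
  "events_of M N V = {V -` A \<inter> space M | A. A \<in> sets N}"

definition F_gen :: "'w measure \<Rightarrow> (nat \<Rightarrow> 'w \<Rightarrow> 'a::topological_space) \<Rightarrow> (nat \<Rightarrow> 'w \<Rightarrow> 'a) \<Rightarrow> nat \<Rightarrow> 'w set set" where
  "F_gen M X Y n = (\<Union>k\<le>n. events_of M borel (X k) \<union> events_of M borel (Y k))"

definition F_alg :: "'w measure \<Rightarrow> (nat \<Rightarrow> 'w \<Rightarrow> 'a::topological_space) \<Rightarrow> (nat \<Rightarrow> 'w \<Rightarrow> 'a) \<Rightarrow> nat \<Rightarrow> 'w measure" where
  "F_alg M X Y n = sigma (space M) (F_gen M X Y n)"

definition G_alg :: "'w measure \<Rightarrow> (nat \<Rightarrow> 'w \<Rightarrow> 'a::topological_space) \<Rightarrow> nat \<Rightarrow> 'w measure" where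
  "G_alg M Y n = sigma (space M) (\<Union>k\<le>n. events_of M borel (Y k))"

(* \<sigma>(F_{n-1}, Z_n), used for n \<ge> 1 *)
definition H_alg :: "'w measure \<Rightarrow> (nat \<Rightarrow> 'w \<Rightarrow> 'a::topological_space) \<Rightarrow> (nat \<Rightarrow> 'w \<Rightarrow> 'a) \<Rightarrow> (nat \<Rightarrow> 'w \<Rightarrow> bool) \<Rightarrow> nat \<Rightarrow> 'w measure" where
  "H_alg M X Y Z n = sigma (space M) (F_gen M X Y (n - 1) \<union> events_of M (count_space UNIV) (Z n))"

definition theta_defined :: "('a \<Rightarrow> real) \<Rightarrow> (nat \<Rightarrow> 'w \<Rightarrow> 'a) \<Rightarrow> nat \<Rightarrow> 'w \<Rightarrow> bool" where
  "theta_defined w Y n \<omega> \<longleftrightarrow> n = 0 \<or> (\<Sum>j=1..n. w (Y j \<omega>)) > 0"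

(* \<theta>_n(g): integral of g against
   \<theta>_n = \<Sum>_{i=1}^n w(Y_i)/\<Sum>_j w(Y_j) \<delta>_{Y_i} (n \<ge> 1), \<theta>_0 = \<delta>_{y0} *)
definition theta_int :: "('a \<Rightarrow> real) \<Rightarrow> (nat \<Rightarrow> 'w \<Rightarrow> 'a) \<Rightarrow> 'a \<Rightarrow> nat \<Rightarrow> 'w \<Rightarrow> ('a \<Rightarrow> real) \<Rightarrow> real" where
  "theta_int w Y y0 n \<omega> g =
     (if n = 0 then g y0
      else (\<Sum>i=1..n. w (Y i \<omega>) / (\<Sum>j=1..n. w (Y j \<omega>)) * g (Y i \<omega>)))"

definition emp_centered :: "'a measure \<Rightarrow> (nat \<Rightarrow> 'w \<Rightarrow> 'a) \<Rightarrow> nat \<Rightarrow> ('a \<Rightarrow> real) \<Rightarrow> 'w \<Rightarrow> real" where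
  "emp_centered \<pi>Y Y n f \<omega> = (1 / real n) * (\<Sum>i=1..n. f (Y i \<omega>)) - (\<integral>x. f x \<partial>\<pi>Y)"

definition Bseq :: "'w measure \<Rightarrow> 'a::topological_space measure \<Rightarrow> (nat \<Rightarrow> 'w \<Rightarrow> 'a) \<Rightarrow> ('a \<Rightarrow> real) \<Rightarrow> int \<Rightarrow> real" where
  "Bseq M \<pi>Y Y w k =
     (if k \<le> 0 then 1
      else supnorm w * (SUP f\<in>bdd1. (\<integral>\<omega>. emp_centered \<pi>Y Y (nat k) f \<omega> \<partial>M))
         + 2 * (supnorm w)^2 * (SUP f\<in>bdd1. (\<integral>\<omega>. (emp_centered \<pi>Y Y (nat k) f \<omega>)^2 \<partial>M)))"

end

theory Submission
  imports Defs
begin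

text \<open>
  Conditioning \<open>X\<^sub>n\<close> on the past replaces \<open>P\<close> by the mixture \<open>(1 - \<epsilon>) P + \<epsilon> \<theta>\<^sub>n\<^sub>-\<^sub>1\<close>. As \<open>\<pi>\<close> is
  invariant under \<open>P\<close>, the total variation error contracts by \<open>1 - \<epsilon>\<close> at each step, up to the bias of
  the self-normalised estimator \<open>\<theta>\<^sub>n\<^sub>-\<^sub>1\<close>. With \<open>a\<close> and \<open>b\<close> the centred empirical means of
  \<open>w (f - \<pi>(f))\<close> and \<open>w\<close>, the error \<open>e\<close> of that estimator satisfies \<open>e (1 + b) = a\<close>, hence
  \<open>e = a - e b\<close>; the first term is linear in the empirical measure and the second is quadratic.

  For the mean square error let \<open>g\<close> solve the Poisson equation \<open>g - (1 - \<epsilon>) P g = f\<close>. The sum of the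
  \<open>f(X\<^sub>i) - \<pi>(f)\<close> splits into a martingale, a telescoping sum and the accumulated resampling errors
  \<open>\<epsilon> (\<theta>\<^sub>k(g) - \<pi>(g))\<close>. The auxiliary process is conditionally independent of the chain, so the martingale
  differences are orthogonal to every functional of \<open>Y\<close>, in particular to the resampling errors, and no
  cross term of order \<open>n powr (3 / 2)\<close> appears. The event that all weights vanish so far shrinks
  with time; on it the new state itself is counted as a resampling error.
\<close>

text \<open>Of all the constants only one is tight: the accumulated resampling errors must enter the
  mean square bound with coefficient one, so each of them needs a second moment of at most
  \<open>F\<^sup>2\<close> times \<open>Bseq\<close>. This is why \<epsilon> multiplies the Poisson
  solution before resampling, which turns the bound \<open>F / \<epsilon>\<close> into
  \<open>F\<close>, and why the second moment of the self-normalised error is estimated by convexity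
  and not by the crude inequality for the square of a sum. The obstacle is that all weights seen so
  far may be zero; the law of a resampled state is then unspecified. The estimates therefore use the
  self-normalised average only as some number \<rho> whose product with the total weight is the
  weighted sum. If the weights vanish, every number qualifies, in particular a function of the new
  state. The price is that the resampling error at step k may depend on the chain at time k + 1: it
  is then neither known before that step nor a functional of the auxiliary process, which shapes
  both the bias estimate and the orthogonality argument.\<close>

section \<open>Suprema and the total variation distance\<close>

lemma abs_le_supnorm: "bounded (range f) \<Longrightarrow> \<bar>f x\<bar> \<le> supnorm f"
  unfolding supnorm_def
  by (rule cSUP_upper) (auto simp: bounded_iff bdd_above_def)

lemma abs_integral_le_bound:
  fixes f :: "'a \<Rightarrow> real"
  assumes "prob_space M" "f \<in> borel_measurable M" "\<And>x. x \<in> space M \<Longrightarrow> \<bar>f x\<bar> \<le> C"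
  shows "\<bar>\<integral>x. f x \<partial>M\<bar> \<le> C"
proof -
  interpret prob_space M by fact
  have int: "integrable M f"
    using assms(2,3) by (intro integrable_const_bound[where B = C]) (auto intro!: AE_I2)
  have "\<bar>\<integral>x. f x \<partial>M\<bar> \<le> (\<integral>x. \<bar>f x\<bar> \<partial>M)"
    by (rule integral_abs_bound)
  also have "\<dots> \<le> (\<integral>x. C \<partial>M)"
    using int assms(3) by (intro integral_mono_AE) (auto intro!: AE_I2)
  also have "\<dots> = C"
    by (simp add: prob_space)
  finally show ?thesis .
qed

text \<open>A real supremum dominates its members only once it is known to be bounded; the bound 2
  for two probability measures supplies this.\<close>

lemma integral_diff_le_tv_dist:
  assumes "prob_space \<mu>" "sets \<mu> = sets borel" "prob_space \<nu>" "sets \<nu> = sets borel" "g \<in> bdd1"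
  shows "\<bar>(\<integral>x. g x \<partial>\<mu>) - (\<integral>x. g x \<partial>\<nu>)\<bar> \<le> 2 * tv_dist \<mu> \<nu>"
proof -
  have "\<bar>\<integral>x. f x \<partial>\<mu>\<bar> \<le> 1" "\<bar>\<integral>x. f x \<partial>\<nu>\<bar> \<le> 1" if "f \<in> bdd1" for f
    using that assms(1-4)
    by (auto simp: bdd1_def measurable_cong_sets[OF assms(2) refl] measurable_cong_sets[OF assms(4) refl]
        intro!: abs_integral_le_bound)
  then have "\<bar>(\<integral>x. f x \<partial>\<mu>) - (\<integral>x. f x \<partial>\<nu>)\<bar> \<le> 2" if "f \<in> bdd1" for f
    using that by (smt (verit))
  then have "bdd_above ((\<lambda>f. \<bar>(\<integral>x. f x \<partial>\<mu>) - (\<integral>x. f x \<partial>\<nu>)\<bar>) ` bdd1)"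
    by (auto simp: bdd_above_def)
  from cSUP_upper[OF assms(5) this] show ?thesis
    by (simp add: tv_dist_def)
qed

lemma zero_in_bdd1: "(\<lambda>_. 0) \<in> bdd1"
  by (simp add: bdd1_def)

lemma tv_dist_leI:
  assumes "\<And>g. g \<in> bdd1 \<Longrightarrow> \<bar>(\<integral>x. g x \<partial>\<mu>) - (\<integral>x. g x \<partial>\<nu>)\<bar> \<le> 2 * c"
  shows "tv_dist \<mu> \<nu> \<le> c"
proof -
  have "bdd1 \<noteq> ({} :: ('a \<Rightarrow> real) set)"
    using zero_in_bdd1 by blast
  from cSUP_least[OF this, of "\<lambda>g. \<bar>(\<integral>x. g x \<partial>\<mu>) - (\<integral>x. g x \<partial>\<nu>)\<bar>", OF assms] show ?thesis
    by (simp add: tv_dist_def)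
qed

section \<open>Markov kernels: the Poisson equation and invariance\<close>

lemma kernel_integral_measurable:
  fixes g :: "'b::topological_space \<Rightarrow> real"
  assumes "P \<in> N \<rightarrow>\<^sub>M prob_algebra borel" "g \<in> borel_measurable borel"
  shows "(\<lambda>x. \<integral>y. g y \<partial>P x) \<in> borel_measurable N"
  using measurable_compose[OF measurable_prob_algebraD[OF assms(1)] integral_measurable_subprob_algebra[OF assms(2)]]
  by simp

lemma kernel_prob_space:
  assumes "P \<in> borel \<rightarrow>\<^sub>M prob_algebra borel"
  shows "prob_space (P x)" "sets (P x) = sets borel"
  using measurable_space[OF assms, of x] by (auto simp: space_prob_algebra)

lemma kernel_integral_bound:
  fixes g :: "'a::topological_space \<Rightarrow> real"
  assumes "P \<in> borel \<rightarrow>\<^sub>M prob_algebra borel" "g \<in> borel_measurable borel" "\<And>x. \<bar>g x\<bar> \<le> C"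
  shows "\<bar>\<integral>y. g y \<partial>P x\<bar> \<le> C"
  using assms kernel_prob_space[OF assms(1), of x]
  by (intro abs_integral_le_bound) (auto simp: measurable_cong_sets[OF kernel_prob_space(2)[OF assms(1)] refl])

text \<open>Neumann series: \<open>G\<close> is the sum over k of
  \<open>(1 - \<epsilon>) ^ k\<close> times the k-fold application of the kernel to
  \<open>f\<close>. A kernel is a contraction in the supremum norm, so the geometric weights alone
  give absolute convergence, however slowly the chain mixes, and \<open>F / \<epsilon>\<close> is
  the geometric sum.\<close>

lemma poisson_equation:
  fixes P :: "'a::topological_space \<Rightarrow> 'a measure" and f :: "'a \<Rightarrow> real"
  assumes P: "P \<in> borel \<rightarrow>\<^sub>M prob_algebra borel"
    and f: "f \<in> borel_measurable borel" "\<And>x. \<bar>f x\<bar> \<le> F"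
    and eps: "0 < \<epsilon>" "\<epsilon> < 1"
  obtains G where "G \<in> borel_measurable borel" "\<And>x. \<bar>G x\<bar> \<le> F / \<epsilon>"
    "\<And>x. G x = f x + (1 - \<epsilon>) * (\<integral>y. G y \<partial>P x)"
proof -
  define u where "u = (\<lambda>k. ((\<lambda>g x. \<integral>y. g y \<partial>P x) ^^ k) f)"
  have u0: "u 0 = f" and uS: "u (Suc k) x = (\<integral>y. u k y \<partial>P x)" for k x
    by (auto simp: u_def)
  have u_meas: "u k \<in> borel_measurable borel" for k
  proof (induction k)
    case (Suc k)
    have "u (Suc k) = (\<lambda>x. \<integral>y. u k y \<partial>P x)"
      by (auto simp: uS)
    with kernel_integral_measurable[OF P Suc] show ?case
      by simp
  qed (use f in \<open>simp add: u0\<close>)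
  have u_bd: "\<bar>u k x\<bar> \<le> F" for k x
  proof (induction k arbitrary: x)
    case (Suc k)
    show ?case
      unfolding uS using P u_meas Suc by (rule kernel_integral_bound)
  qed (use f in \<open>simp add: u0\<close>)
  define v where "v = (\<lambda>k x. (1 - \<epsilon>) ^ k * u k x)"
  have v_bd: "\<bar>v k x\<bar> \<le> (1 - \<epsilon>) ^ k * F" for k x
    using eps u_bd[of k x] by (simp add: v_def abs_mult mult_left_mono)
  have geo: "(\<lambda>k. (1 - \<epsilon>) ^ k * F) sums (F / \<epsilon>)"
    using sums_mult2[OF geometric_sums[of "1 - \<epsilon>"], of F] eps by simp
  have sum_norm: "summable (\<lambda>k. norm (v k x))" for x
    by (rule summable_comparison_test'[OF sums_summable[OF geo], of 0]) (simp add: v_bd)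
  have v_meas: "v k \<in> borel_measurable borel" for k
    unfolding v_def using u_meas by simp
  define G where "G = (\<lambda>x. \<Sum>k. v k x)"
  show thesis
  proof
    show "G \<in> borel_measurable borel"
      unfolding G_def by (intro borel_measurable_suminf v_meas)
    show "\<bar>G x\<bar> \<le> F / \<epsilon>" for x
    proof -
      have "\<bar>G x\<bar> \<le> (\<Sum>k. norm (v k x))"
        unfolding G_def using summable_norm[OF sum_norm] by simp
      also have "\<dots> \<le> (\<Sum>k. (1 - \<epsilon>) ^ k * F)"
        using sum_norm geo v_bd by (intro suminf_le) (auto simp: sums_iff)
      finally show ?thesis
        using geo by (simp add: sums_iff)
    qed
    show "G x = f x + (1 - \<epsilon>) * (\<integral>y. G y \<partial>P x)" for x
    proof -
      interpret Px: prob_space "P x" by (rule kernel_prob_space[OF P])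
      have [measurable_cong]: "sets (P x) = sets borel" by (rule kernel_prob_space[OF P])
      note u_meas[measurable] v_meas[measurable]
      have int: "integrable (P x) (v k)" for k
        by (rule Px.integrable_const_bound[where B = "(1 - \<epsilon>) ^ k * F"]) (use v_bd in auto)
      have le: "(\<integral>y. norm (v k y) \<partial>P x) \<le> (1 - \<epsilon>) ^ k * F" for k
        using abs_integral_le_bound[OF Px.prob_space_axioms, of "\<lambda>y. norm (v k y)" "(1 - \<epsilon>) ^ k * F"] v_bd
        by (auto simp: abs_le_iff)
      have "summable (\<lambda>k. \<integral>y. norm (v k y) \<partial>P x)"
        by (rule summable_comparison_test'[OF sums_summable[OF geo], of 0])
          (use le in \<open>auto simp: integral_nonneg_AE\<close>)
      \<comment> \<open>Applying the kernel shifts the series by one index; the head term that is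
        lost is \<open>f\<close>.\<close>
      from integral_suminf[OF int AE_I2[OF sum_norm] this]
      have "(\<integral>y. G y \<partial>P x) = (\<Sum>k. (1 - \<epsilon>) ^ k * u (Suc k) x)"
        by (simp add: G_def v_def uS)
      moreover have "summable (\<lambda>k. (1 - \<epsilon>) ^ k * u (Suc k) x)"
      proof (rule summable_comparison_test'[OF sums_summable[OF geo], of 0])
        show "norm ((1 - \<epsilon>) ^ k * u (Suc k) x) \<le> (1 - \<epsilon>) ^ k * F" for k
          using eps u_bd[of "Suc k" x] by (simp add: abs_mult mult_left_mono)
      qed
      ultimately have "(1 - \<epsilon>) * (\<integral>y. G y \<partial>P x) = (\<Sum>k. v (Suc k) x)"
        by (simp add: v_def suminf_mult[symmetric] mult.assoc)
      moreover have "G x = v 0 x + (\<Sum>k. v (Suc k) x)"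
        unfolding G_def using suminf_split_head[OF summable_norm_cancel[OF sum_norm]] by simp
      ultimately show ?thesis
        by (simp add: v_def u0)
    qed
  qed
qed

text \<open>Stationarity is given on sets only. It says that \<pi> is the join of its own image
  under the kernel, and integration against a join carries this over to bounded functions.\<close>

lemma invariant_integral:
  fixes P :: "'a::topological_space \<Rightarrow> 'a measure" and g :: "'a \<Rightarrow> real"
  assumes P: "P \<in> borel \<rightarrow>\<^sub>M prob_algebra borel"
    and pi: "prob_space \<pi>" "sets \<pi> = sets borel"
    and stat: "\<forall>A\<in>sets borel. (\<integral>x. measure (P x) A \<partial>\<pi>) = measure \<pi> A"
    and g: "g \<in> borel_measurable borel" "\<And>x. \<bar>g x\<bar> \<le> C"
  shows "(\<integral>x. \<integral>y. g y \<partial>P x \<partial>\<pi>) = (\<integral>x. g x \<partial>\<pi>)"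
proof -
  interpret \<pi>: prob_space \<pi> by fact
  note pi(2)[measurable_cong]
  have PM: "P \<in> \<pi> \<rightarrow>\<^sub>M subprob_algebra borel"
    using measurable_prob_algebraD[OF P] by (simp add: measurable_cong_sets[OF pi(2) refl])
  have ne: "space \<pi> \<noteq> {}" by (rule \<pi>.not_empty)
  have sp: "space \<pi> = UNIV" using sets_eq_imp_space_eq[OF pi(2)] by simp
  have bind: "join (distr \<pi> (subprob_algebra borel) P) = \<pi>"
  proof (rule measure_eqI)
    fix A assume "A \<in> sets (join (distr \<pi> (subprob_algebra borel) P))"
    then have A: "A \<in> sets borel" by simp
    have "emeasure (join (distr \<pi> (subprob_algebra borel) P)) A = (\<integral>\<^sup>+x. emeasure (P x) A \<partial>\<pi>)"
      using emeasure_bind[OF ne PM A] bind_nonempty''[OF PM ne] by simp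
    also have "\<dots> = (\<integral>\<^sup>+x. ennreal (measure (P x) A) \<partial>\<pi>)"
      using kernel_prob_space(1)[OF P]
      by (intro nn_integral_cong) (simp add: finite_measure.emeasure_eq_measure prob_space.finite_measure)
    also have "\<dots> = ennreal (\<integral>x. measure (P x) A \<partial>\<pi>)"
    proof (rule nn_integral_eq_integral)
      show "integrable \<pi> (\<lambda>x. measure (P x) A)"
        using kernel_prob_space(1)[OF P] measurable_compose[OF PM measurable_measure_subprob_algebra[OF A]]
        by (intro \<pi>.integrable_const_bound[where B = 1]) (auto simp: prob_space.prob_le_1)
    qed simp
    finally show "emeasure (join (distr \<pi> (subprob_algebra borel) P)) A = emeasure \<pi> A"
      using stat A by (simp add: \<pi>.emeasure_eq_measure)
  qed (simp add: pi)
  have "(\<integral>x. g x \<partial>\<pi>) = (\<integral>M'. integral\<^sup>L M' g \<partial>distr \<pi> (subprob_algebra borel) P)"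
    unfolding bind[THEN arg_cong, of "\<lambda>N. integral\<^sup>L N g", symmetric]
  proof (rule integral_join[where B' = 1])
    show "g \<in> borel_measurable borel" by fact
    show "\<bar>g x\<bar> \<le> C" for x by fact
    show "finite_measure (distr \<pi> (subprob_algebra borel) P)"
      using \<pi>.finite_measure_distr PM by blast
    show "AE M' in distr \<pi> (subprob_algebra borel) P. emeasure M' (space M') \<le> ennreal 1"
      using kernel_prob_space(1)[OF P]
      by (subst AE_distr_iff[OF PM]) (auto simp: prob_space.emeasure_space_1)
  qed simp
  also have "\<dots> = (\<integral>x. \<integral>y. g y \<partial>P x \<partial>\<pi>)"
    using PM integral_measurable_subprob_algebra[OF g(1)] by (rule integral_distr)
  finally show ?thesis by simp
qed

section \<open>Second moments and a telescoping sum\<close>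

text \<open>Cauchy-Schwarz through a weighted Young inequality. The strictly larger
  \<open>a'\<close> and \<open>b'\<close> keep the weights \<open>b' / a'\<close> and
  \<open>a' / b'\<close> defined when \<open>a\<close> or \<open>b\<close> is zero; at the end they
  tend to \<open>a\<close> and \<open>b\<close>.\<close>

lemma (in prob_space) integral_mult_le_sqrt:
  fixes f g :: "'a \<Rightarrow> real"
  assumes [measurable]: "integrable M (\<lambda>x. (f x)\<^sup>2)" "integrable M (\<lambda>x. (g x)\<^sup>2)" "integrable M (\<lambda>x. f x * g x)"
    and le: "(\<integral>x. (f x)\<^sup>2 \<partial>M) \<le> a\<^sup>2" "(\<integral>x. (g x)\<^sup>2 \<partial>M) \<le> b\<^sup>2" and nn: "0 \<le> a" "0 \<le> b"
  shows "(\<integral>x. f x * g x \<partial>M) \<le> a * b"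
proof -
  have "(\<integral>x. f x * g x \<partial>M) \<le> a' * b'" if "a' > a" "b' > b" for a' b'
  proof -
    have pos: "a' > 0" "b' > 0" using that nn by auto
    have "f x * g x \<le> (b' / (2 * a')) * (f x)\<^sup>2 + (a' / (2 * b')) * (g x)\<^sup>2" for x
    proof -
      have "0 \<le> (b' * f x - a' * g x)\<^sup>2 / (2 * a' * b')" using pos by simp
      also have "\<dots> = (b' / (2 * a')) * (f x)\<^sup>2 + (a' / (2 * b')) * (g x)\<^sup>2 - f x * g x"
        using pos by (simp add: power2_eq_square field_simps)
      finally show ?thesis by simp
    qed
    then have "(\<integral>x. f x * g x \<partial>M) \<le> (\<integral>x. (b' / (2 * a')) * (f x)\<^sup>2 + (a' / (2 * b')) * (g x)\<^sup>2 \<partial>M)"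
      using assms(1-3) by (intro integral_mono) auto
    also have "\<dots> = (b' / (2 * a')) * (\<integral>x. (f x)\<^sup>2 \<partial>M) + (a' / (2 * b')) * (\<integral>x. (g x)\<^sup>2 \<partial>M)"
      using assms(1-3) by simp
    also have "\<dots> \<le> (b' / (2 * a')) * a'\<^sup>2 + (a' / (2 * b')) * b'\<^sup>2"
    proof -
      have "a\<^sup>2 \<le> a'\<^sup>2" "b\<^sup>2 \<le> b'\<^sup>2" using that nn by (auto intro!: power_mono)
      with le pos show ?thesis by (intro add_mono mult_left_mono) auto
    qed
    also have "\<dots> = a' * b'" using pos by (simp add: power2_eq_square)
    finally show ?thesis .
  qed
  then have ev: "(\<integral>x. f x * g x \<partial>M) \<le> (a + inverse (real (Suc n))) * (b + inverse (real (Suc n)))" for n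
    by simp
  have "(\<lambda>n. (a + inverse (real (Suc n))) * (b + inverse (real (Suc n)))) \<longlonglongrightarrow> (a + 0) * (b + 0)"
    by (intro tendsto_intros LIMSEQ_inverse_real_of_nat)
  from LIMSEQ_le_const[OF this] ev show ?thesis by auto
qed

text \<open>The triangle inequality in L2, for summands about whose correlations nothing is known.
  It is the source of the squared sum of square roots in the theorem.\<close>

lemma (in prob_space) integral_sum_square_le:
  fixes q :: "'i \<Rightarrow> 'a \<Rightarrow> real"
  assumes "\<And>i j. i \<in> I \<Longrightarrow> j \<in> I \<Longrightarrow> integrable M (\<lambda>x. q i x * q j x)"
    and "\<And>i. i \<in> I \<Longrightarrow> (\<integral>x. (q i x)\<^sup>2 \<partial>M) \<le> (c i)\<^sup>2" "\<And>i. i \<in> I \<Longrightarrow> 0 \<le> c i"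
  shows "(\<integral>x. (\<Sum>i\<in>I. q i x)\<^sup>2 \<partial>M) \<le> (\<Sum>i\<in>I. c i)\<^sup>2"
proof -
  have "(\<integral>x. (\<Sum>i\<in>I. q i x)\<^sup>2 \<partial>M) = (\<Sum>i\<in>I. \<Sum>j\<in>I. \<integral>x. q i x * q j x \<partial>M)"
    using assms(1) by (simp add: power2_eq_square sum_product)
  also have "\<dots> \<le> (\<Sum>i\<in>I. \<Sum>j\<in>I. c i * c j)"
    using assms by (intro sum_mono integral_mult_le_sqrt) (simp_all add: power2_eq_square)
  finally show ?thesis by (simp add: power2_eq_square sum_product)
qed

text \<open>An upward closed condition selects a final segment of the indices, so the restricted sum
  still telescopes to a difference of two values; if nothing is selected, both values
  coincide.\<close>

lemma telescoping_tail:
  fixes c :: "nat \<Rightarrow> real"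
  assumes "\<And>k. D k \<Longrightarrow> D (Suc k)"
  shows "\<exists>j. (\<Sum>k=1..<Suc n. if D k then c k - c (Suc k) else 0) = c j - c (Suc n)"
proof (induction n)
  case (Suc n)
  then obtain j where j: "(\<Sum>k=1..<Suc n. if D k then c k - c (Suc k) else 0) = c j - c (Suc n)"
    by auto
  show ?case
  proof (cases "D (Suc n)")
    case True
    then show ?thesis using j by (intro exI[of _ j]) simp
  next
    case False
    have "\<not> D k" if "k \<le> Suc n" for k
      using that False assms by (induction rule: inc_induct) auto
    then have "(\<Sum>k=1..<Suc (Suc n). if D k then c k - c (Suc k) else 0) = 0"
      by (intro sum.neutral) auto
    then show ?thesis by (intro exI[of _ "Suc (Suc n)"]) simp
  qed
qed auto

section \<open>Conditional expectations and generated \<sigma>-algebras\<close>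

lemma integrable_mult_bounded:
  fixes g :: "'a \<Rightarrow> real"
  assumes V: "integrable M V" and g: "g \<in> borel_measurable M" "\<And>x. x \<in> space M \<Longrightarrow> \<bar>g x\<bar> \<le> C"
  shows "integrable M (\<lambda>x. V x * g x)"
proof (rule Bochner_Integration.integrable_bound[of _ "\<lambda>x. C * V x"])
  show "AE x in M. norm (V x * g x) \<le> norm (C * V x)"
  proof (rule AE_I2)
    fix x assume "x \<in> space M"
    from g(2)[OF this] have "\<bar>g x\<bar> \<le> \<bar>C\<bar>" by simp
    then show "norm (V x * g x) \<le> norm (C * V x)"
      using mult_left_mono[of "\<bar>g x\<bar>" "\<bar>C\<bar>" "\<bar>V x\<bar>"] by (simp add: abs_mult mult.commute)
  qed
qed (use V g in auto)

text \<open>The multiplier \<open>V\<close> is only asked to be integrable because it will itself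
  contain conditional expectations, for which no pointwise bound is at hand.\<close>

lemma real_cond_exp_integral_mult:
  fixes g :: "'a \<Rightarrow> real"
  assumes "prob_space M" "subalgebra M N" and V: "V \<in> borel_measurable N" "integrable M V"
    and g: "g \<in> borel_measurable M" "\<And>x. x \<in> space M \<Longrightarrow> \<bar>g x\<bar> \<le> C"
  shows "integrable M (\<lambda>x. V x * real_cond_exp M N g x)"
    and "(\<integral>x. V x * g x \<partial>M) = (\<integral>x. V x * real_cond_exp M N g x \<partial>M)"
proof -
  interpret prob_space M by fact
  interpret sigma_finite_subalgebra M N
    by (intro finite_measure_subalgebra_is_sigma_finite finite_measure_subalgebra.intro
        finite_measure_subalgebra_axioms.intro assms finite_measure_axioms)
  from real_cond_exp_intg[OF integrable_mult_bounded[OF V(2) g] V(1) g(1)]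
  show "integrable M (\<lambda>x. V x * real_cond_exp M N g x)"
    and "(\<integral>x. V x * g x \<partial>M) = (\<integral>x. V x * real_cond_exp M N g x \<partial>M)"
    by simp_all
qed

text \<open>If \<open>d\<close> integrates to zero over every set of \<open>N\<close>, its
  conditional expectation given \<open>N\<close> vanishes almost everywhere, and \<open>V\<close>
  can be pulled out.\<close>

lemma integral_mult_eq_0_of_sets:
  fixes d :: "'a \<Rightarrow> real"
  assumes "prob_space M" "subalgebra M N" and V: "V \<in> borel_measurable N" "integrable M V"
    and d: "d \<in> borel_measurable M" "\<And>x. x \<in> space M \<Longrightarrow> \<bar>d x\<bar> \<le> C"
    and sets: "\<And>A. A \<in> sets N \<Longrightarrow> (\<integral>x. d x * indicator A x \<partial>M) = 0"
  shows "(\<integral>x. d x * V x \<partial>M) = 0"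
proof -
  interpret prob_space M by fact
  interpret sigma_finite_subalgebra M N
    by (intro finite_measure_subalgebra_is_sigma_finite finite_measure_subalgebra.intro
        finite_measure_subalgebra_axioms.intro assms finite_measure_axioms)
  have "integrable M d"
    by (rule integrable_const_bound[where B = C]) (use d in \<open>auto intro!: AE_I2\<close>)
  then have "AE x in M. real_cond_exp M N d x = 0"
    using sets by (intro real_cond_exp_charact) (auto simp: set_lebesgue_integral_def mult.commute)
  then have "(\<integral>x. V x * real_cond_exp M N d x \<partial>M) = (\<integral>x. 0 \<partial>M)"
    using V by (intro integral_cong_AE) auto
  with real_cond_exp_integral_mult(2)[OF assms(1,2) V d] show ?thesis
    by (simp add: mult.commute)
qed

lemma measurable_sigma_events:
  assumes "S \<subseteq> Pow (space M)" "events_of M K V \<subseteq> S" "V \<in> space M \<rightarrow> space K"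
  shows "V \<in> sigma (space M) S \<rightarrow>\<^sub>M K"
proof (rule measurableI)
  show "V -` A \<inter> space (sigma (space M) S) \<in> sets (sigma (space M) S)" if "A \<in> sets K" for A
    using that assms(1,2) by (auto simp: events_of_def intro!: sigma_sets.Basic)
qed (use assms in auto)

lemma subalgebra_sigma:
  assumes "S \<subseteq> sets M"
  shows "subalgebra M (sigma (space M) S)"
  using sets.sigma_sets_subset[OF assms] sets.space_closed[of M] assms
  by (auto simp: subalgebra_def)

lemma subalgebra_sigma_mono:
  assumes "S \<subseteq> T" "T \<subseteq> Pow \<Omega>"
  shows "subalgebra (sigma \<Omega> T) (sigma \<Omega> S)"
  using assms sigma_sets_mono'[OF assms(1), of \<Omega>] by (auto simp: subalgebra_def)

lemma events_of_subset_sets: "V \<in> M \<rightarrow>\<^sub>M K \<Longrightarrow> events_of M K V \<subseteq> sets M"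
  by (auto simp: events_of_def)

section \<open>The algorithm and its target measures\<close>

locale ir_mcmc = prob_space M for M :: "'w measure" +
  fixes dx \<pi> \<pi>Y :: "'a::polish_space measure"
    and p q w :: "'a \<Rightarrow> real"
    and P :: "'a \<Rightarrow> 'a measure"
    and \<epsilon> :: real
    and x0 y0 :: 'a
    and X Y :: "nat \<Rightarrow> 'w \<Rightarrow> 'a"
    and Z :: "nat \<Rightarrow> 'w \<Rightarrow> bool"
  assumes dx: "sets dx = sets borel"
    and p: "p \<in> borel_measurable borel" "\<forall>x. p x \<ge> 0" "\<pi> = density dx (\<lambda>x. ennreal (p x))"
           "prob_space \<pi>"
    and q: "q \<in> borel_measurable borel" "\<forall>x. q x \<ge> 0" "\<pi>Y = density dx (\<lambda>x. ennreal (q x))"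
           "prob_space \<pi>Y"
    and w: "\<forall>x. q x = 0 \<longrightarrow> p x = 0" "w = (\<lambda>x. p x / q x)" "bounded (range w)"
    and eps: "0 < \<epsilon>" "\<epsilon> < 1"
    and P_kernel: "P \<in> borel \<rightarrow>\<^sub>M prob_algebra borel"
    and P_stat: "\<forall>A\<in>sets borel. (\<integral>x. measure (P x) A \<partial>\<pi>) = measure \<pi> A"
    and meas: "\<forall>n. X n \<in> M \<rightarrow>\<^sub>M borel" "\<forall>n. Y n \<in> M \<rightarrow>\<^sub>M borel"
              "\<forall>n. Z n \<in> M \<rightarrow>\<^sub>M count_space UNIV"
    and Y_aux: "\<forall>n h. h \<in> borel_measurable borel \<longrightarrow> bounded (range h) \<longrightarrow>
        (AE \<omega> in M. real_cond_exp M (F_alg M X Y n) (\<lambda>\<omega>. h (Y (Suc n) \<omega>)) \<omega>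
                    = real_cond_exp M (G_alg M Y n) (\<lambda>\<omega>. h (Y (Suc n) \<omega>)) \<omega>)"
    and cond_indep: "\<forall>n g h. n \<ge> 1 \<longrightarrow> g \<in> borel_measurable borel \<longrightarrow> bounded (range g) \<longrightarrow>
        h \<in> borel_measurable borel \<longrightarrow> bounded (range h) \<longrightarrow>
        (AE \<omega> in M. real_cond_exp M (F_alg M X Y (n - 1)) (\<lambda>\<omega>. g (X n \<omega>) * h (Y n \<omega>)) \<omega>
           = real_cond_exp M (F_alg M X Y (n - 1)) (\<lambda>\<omega>. g (X n \<omega>)) \<omega>
             * real_cond_exp M (F_alg M X Y (n - 1)) (\<lambda>\<omega>. h (Y n \<omega>)) \<omega>)"
    and Z_bern: "\<forall>n\<ge>1. prob {\<omega>\<in>space M. Z n \<omega>} = \<epsilon>"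
    and Z_indep: "\<forall>n\<ge>1. indep_set (events_of M (count_space UNIV) (Z n))
        (sigma_sets (space M) (F_gen M X Y (n - 1) \<union> (\<Union>k. events_of M borel (Y k))))"
    and X_step: "\<forall>n g. n \<ge> 1 \<longrightarrow> g \<in> borel_measurable borel \<longrightarrow> bounded (range g) \<longrightarrow>
        (AE \<omega> in M.
           (Z n \<omega> \<longrightarrow> theta_defined w Y (n - 1) \<omega> \<longrightarrow>
              real_cond_exp M (H_alg M X Y Z n) (\<lambda>\<omega>. g (X n \<omega>)) \<omega> = theta_int w Y y0 (n - 1) \<omega> g)
         \<and> (\<not> Z n \<omega> \<longrightarrow>
              real_cond_exp M (H_alg M X Y Z n) (\<lambda>\<omega>. g (X n \<omega>)) \<omega> = (\<integral>y. g y \<partial>P (X (n - 1) \<omega>))))"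
begin

abbreviation "\<F> \<equiv> F_alg M X Y"
abbreviation "\<G> \<equiv> G_alg M Y"
text \<open>Shifted by one: the information of \<open>\<F> k\<close> together with the coin
  \<open>Z (Suc k)\<close>, that is, what is known just before \<open>X (Suc k)\<close> is
  drawn.\<close>

abbreviation "\<H> k \<equiv> H_alg M X Y Z (Suc k)"
abbreviation "emp \<equiv> emp_centered \<pi>Y Y"
abbreviation "\<theta> k g \<omega> \<equiv> theta_int w Y y0 k \<omega> g"

definition Pf :: "('a \<Rightarrow> real) \<Rightarrow> 'a \<Rightarrow> real" where
  "Pf g x = (\<integral>y. g y \<partial>P x)"

text \<open>Like \<open>\<zeta>\<close> below, a real-valued indicator: case distinctions become
  factors under the integral.\<close>

definition \<delta> :: "nat \<Rightarrow> 'w \<Rightarrow> real" where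
  "\<delta> k \<omega> = (if theta_defined w Y k \<omega> then 1 else 0)"

definition \<zeta> :: "nat \<Rightarrow> 'w \<Rightarrow> real" where
  "\<zeta> k \<omega> = (if Z k \<omega> then 1 else 0)"

lemma process_measurable [measurable]:
  "X n \<in> M \<rightarrow>\<^sub>M borel" "Y n \<in> M \<rightarrow>\<^sub>M borel" "Z n \<in> M \<rightarrow>\<^sub>M count_space UNIV"
  using meas by auto

lemma Pf_measurable: "g \<in> borel_measurable borel \<Longrightarrow> Pf g \<in> borel_measurable borel"
  unfolding Pf_def by (rule kernel_integral_measurable[OF P_kernel])

lemma Pf_bound: "g \<in> borel_measurable borel \<Longrightarrow> (\<And>x. \<bar>g x\<bar> \<le> C) \<Longrightarrow> \<bar>Pf g x\<bar> \<le> C"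
  unfolding Pf_def by (rule kernel_integral_bound[OF P_kernel])

lemma sets_targets [measurable_cong]: "sets \<pi> = sets borel" "sets \<pi>Y = sets borel"
  by (simp_all add: p q dx)

lemma w_measurable [measurable]: "w \<in> borel_measurable borel"
  using p(1) q(1) by (simp add: w(2))

lemma w_nonneg: "0 \<le> w x"
  using p(2) q(2) by (simp add: w(2))

lemma w_le: "w x \<le> supnorm w"
  using abs_le_supnorm[OF w(3), of x] by simp

lemma supnorm_w_nonneg: "0 \<le> supnorm w"
  using w_le[of undefined] w_nonneg[of undefined] by simp

lemma integral_target_eq:
  fixes g :: "'a \<Rightarrow> real"
  assumes [measurable]: "g \<in> borel_measurable borel"
  shows "(\<integral>x. g x \<partial>\<pi>) = (\<integral>x. w x * g x \<partial>\<pi>Y)"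
proof -
  note [measurable] = p(1) q(1)
  note dx[measurable_cong]
  have "(\<integral>x. g x \<partial>\<pi>) = (\<integral>x. p x *\<^sub>R g x \<partial>dx)"
    unfolding p(3) using p(2) by (intro integral_density) auto
  also have "\<dots> = (\<integral>x. q x *\<^sub>R (w x * g x) \<partial>dx)"
    \<comment> \<open>Where \<open>q\<close> vanishes, \<open>p\<close> does too by absolute
      continuity, and the quotient is multiplied by zero.\<close>
    using w(1) by (intro Bochner_Integration.integral_cong refl) (auto simp: w(2))
  also have "\<dots> = (\<integral>x. w x * g x \<partial>\<pi>Y)"
    unfolding q(3) using q(2) by (intro integral_density[symmetric]) auto
  finally show ?thesis .
qed

lemma integrable_targets:
  fixes \<phi> :: "'a \<Rightarrow> real"
  assumes [measurable]: "\<phi> \<in> borel_measurable borel" and "\<And>x. \<bar>\<phi> x\<bar> \<le> C"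
  shows "integrable \<pi> \<phi>" "integrable \<pi>Y \<phi>"
proof -
  interpret \<pi>: prob_space \<pi> by (rule p)
  interpret \<pi>Y: prob_space \<pi>Y by (rule q)
  show "integrable \<pi> \<phi>"
    by (rule \<pi>.integrable_const_bound[where B = C]) (use assms in auto)
  show "integrable \<pi>Y \<phi>"
    by (rule \<pi>Y.integrable_const_bound[where B = C]) (use assms in auto)
qed

lemma integral_target_bound:
  fixes \<phi> :: "'a \<Rightarrow> real"
  assumes [measurable]: "\<phi> \<in> borel_measurable borel" and "\<And>x. \<bar>\<phi> x\<bar> \<le> C"
  shows "\<bar>\<integral>x. \<phi> x \<partial>\<pi>\<bar> \<le> C" "\<bar>\<integral>x. \<phi> x \<partial>\<pi>Y\<bar> \<le> C"
  by (rule abs_integral_le_bound; use assms p q in measurable)+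

subsection \<open>Weighted empirical averages\<close>

lemma emp_add:
  fixes \<phi> \<psi> :: "'a \<Rightarrow> real"
  assumes "\<phi> \<in> borel_measurable borel" "\<psi> \<in> borel_measurable borel"
    and "\<And>x. \<bar>\<phi> x\<bar> \<le> C" "\<And>x. \<bar>\<psi> x\<bar> \<le> C'"
  shows "emp k (\<lambda>x. \<phi> x + \<psi> x) \<omega> = emp k \<phi> \<omega> + emp k \<psi> \<omega>"
  using integrable_targets(2)[OF assms(1,3)] integrable_targets(2)[OF assms(2,4)]
  by (simp add: emp_centered_def sum.distrib algebra_simps)

lemma emp_cmult: "emp k (\<lambda>x. c * \<phi> x) \<omega> = c * emp k \<phi> \<omega>"
  by (simp add: emp_centered_def sum_distrib_left algebra_simps)

text \<open>At \<open>k = 0\<close> the empirical average is 0 by the convention for division, so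
  constants are centred to zero only from \<open>k = 1\<close> on.\<close>

lemma emp_const: "0 < k \<Longrightarrow> emp k (\<lambda>_. c) \<omega> = 0"
  using prob_space.prob_space[OF q(4)] by (simp add: emp_centered_def)

lemma emp_bound:
  assumes "\<phi> \<in> borel_measurable borel" "\<And>x. \<bar>\<phi> x\<bar> \<le> C"
  shows "\<bar>emp k \<phi> \<omega>\<bar> \<le> 2 * C"
proof -
  have "\<bar>(1 / real k) * (\<Sum>i=1..k. \<phi> (Y i \<omega>))\<bar> \<le> C"
  proof (cases "k = 0")
    case True
    then show ?thesis using assms(2)[of undefined] by simp
  next
    case False
    have "\<bar>\<Sum>i=1..k. \<phi> (Y i \<omega>)\<bar> \<le> (\<Sum>i=1..k. C)"
      by (rule order_trans[OF sum_abs sum_mono]) (simp add: assms)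
    then show ?thesis using False by (simp add: abs_mult field_simps)
  qed
  with integral_target_bound(2)[OF assms] show ?thesis
    unfolding emp_centered_def by linarith
qed

lemma emp_measurable [measurable (raw)]:
  assumes "\<And>i. i \<le> k \<Longrightarrow> Y i \<in> N \<rightarrow>\<^sub>M borel" and [measurable]: "\<phi> \<in> borel_measurable borel"
  shows "emp k \<phi> \<in> borel_measurable N"
proof -
  have "(\<lambda>\<omega>. \<phi> (Y i \<omega>)) \<in> borel_measurable N" if "i \<le> k" for i
    using measurable_compose[OF assms(1)[OF that] assms(2)] .
  then have "(\<lambda>\<omega>. \<Sum>i=1..k. \<phi> (Y i \<omega>)) \<in> borel_measurable N"
    by (intro borel_measurable_sum) auto
  then show ?thesis
    unfolding emp_centered_def by measurable
qed

lemma emp_integrable: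
  assumes [measurable]: "\<phi> \<in> borel_measurable borel" and "\<And>x. \<bar>\<phi> x\<bar> \<le> C"
  shows "integrable M (emp k \<phi>)" "integrable M (\<lambda>\<omega>. (emp k \<phi> \<omega>)\<^sup>2)"
proof -
  show "integrable M (emp k \<phi>)"
    by (rule integrable_const_bound[where B = "2 * C"]) (use emp_bound[OF assms] in auto)
  have "(emp k \<phi> \<omega>)\<^sup>2 \<le> (2 * C)\<^sup>2" for \<omega>
    using power_mono[OF emp_bound[OF assms] abs_ge_zero, where n = 2] by simp
  then show "integrable M (\<lambda>\<omega>. (emp k \<phi> \<omega>)\<^sup>2)"
    by (intro integrable_const_bound[where B = "(2 * C)\<^sup>2"]) auto
qed

definition D1 :: "nat \<Rightarrow> real" where
  "D1 k = (SUP f\<in>bdd1. (\<integral>\<omega>. emp k f \<omega> \<partial>M))"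

definition D2 :: "nat \<Rightarrow> real" where
  "D2 k = (SUP f\<in>bdd1. (\<integral>\<omega>. (emp k f \<omega>)\<^sup>2 \<partial>M))"

lemma Bseq_eq: "0 < k \<Longrightarrow> Bseq M \<pi>Y Y w (int k) = supnorm w * D1 k + 2 * (supnorm w)\<^sup>2 * D2 k"
  by (simp add: Bseq_def D1_def D2_def)

lemma emp_le_D:
  assumes "f \<in> bdd1"
  shows "(\<integral>\<omega>. emp k f \<omega> \<partial>M) \<le> D1 k" "(\<integral>\<omega>. (emp k f \<omega>)\<^sup>2 \<partial>M) \<le> D2 k"
proof -
  have b: "\<bar>emp k f \<omega>\<bar> \<le> 2" "f \<in> borel_measurable borel" if "f \<in> bdd1" for f \<omega>
    using emp_bound[of f 1 k \<omega>] that by (auto simp: bdd1_def)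
  have "(\<integral>\<omega>. emp k f \<omega> \<partial>M) \<le> 2" if "f \<in> bdd1" for f
    using abs_integral_le_bound[OF prob_space_axioms, of "emp k f" 2] b[OF that] by (auto simp: abs_le_iff)
  then have "bdd_above ((\<lambda>f. \<integral>\<omega>. emp k f \<omega> \<partial>M) ` bdd1)"
    by (auto simp: bdd_above_def)
  from cSUP_upper[OF assms this] show "(\<integral>\<omega>. emp k f \<omega> \<partial>M) \<le> D1 k"
    by (simp add: D1_def)
  have "(\<integral>\<omega>. (emp k f \<omega>)\<^sup>2 \<partial>M) \<le> 4" if "f \<in> bdd1" for f
  proof -
    have "(emp k f \<omega>)\<^sup>2 \<le> 4" for \<omega>
      using b(1)[OF that, of \<omega>] abs_le_square_iff[of "emp k f \<omega>" 2] by simp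
    then show ?thesis
      using abs_integral_le_bound[OF prob_space_axioms, of "\<lambda>\<omega>. (emp k f \<omega>)\<^sup>2" 4] b(2)[OF that]
      by (auto simp: abs_le_iff)
  qed
  then have "bdd_above ((\<lambda>f. \<integral>\<omega>. (emp k f \<omega>)\<^sup>2 \<partial>M) ` bdd1)"
    by (auto simp: bdd_above_def)
  from cSUP_upper[OF assms this] show "(\<integral>\<omega>. (emp k f \<omega>)\<^sup>2 \<partial>M) \<le> D2 k"
    by (simp add: D2_def)
qed

lemma D_nonneg: "0 < k \<Longrightarrow> 0 \<le> D1 k" "0 < k \<Longrightarrow> 0 \<le> D2 k"
  using emp_le_D[OF zero_in_bdd1, of k] by (simp_all add: emp_const)

text \<open>The supremum in \<open>D1\<close> carries no absolute value. As \<open>bdd1\<close> is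
  closed under negation, testing with both signs bounds the mean from both sides.\<close>

lemma emp_mean_le:
  assumes [measurable]: "\<phi> \<in> borel_measurable borel" and b: "\<And>x. \<bar>\<phi> x\<bar> \<le> C"
  shows "\<bar>\<integral>\<omega>. emp k \<phi> \<omega> \<partial>M\<bar> \<le> C * D1 k"
proof (cases "C = 0")
  case True
  then have "\<phi> = (\<lambda>_. 0)" using b by auto
  then show ?thesis using True by (simp add: emp_centered_def)
next
  case False
  then have C: "C > 0" using b[of undefined] by simp
  have in1: "(\<lambda>x. (s / C) * \<phi> x) \<in> bdd1" if "\<bar>s\<bar> = 1" for s
    using b C that by (simp add: bdd1_def abs_mult)
  have "s / C * (\<integral>\<omega>. emp k \<phi> \<omega> \<partial>M) \<le> D1 k" if "\<bar>s\<bar> = 1" for s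
    using emp_le_D(1)[OF in1[OF that], of k] unfolding emp_cmult by simp
  from this[of 1] this[of "-1"] C show ?thesis
    by (simp add: abs_le_iff field_simps)
qed

text \<open>Centred averages do not see constants, so only the oscillation of the integrand counts.
  For a nonnegative integrand, centring at the midpoint of its range halves the bound and saves a
  factor 4 in the square.\<close>

lemma emp_square_le:
  assumes k: "0 < k" and [measurable]: "\<phi> \<in> borel_measurable borel" and b: "\<And>x. \<bar>\<phi> x - c\<bar> \<le> C"
  shows "(\<integral>\<omega>. (emp k \<phi> \<omega>)\<^sup>2 \<partial>M) \<le> C\<^sup>2 * D2 k"
proof -
  have "emp k \<phi> \<omega> = emp k (\<lambda>x. (\<phi> x - c) + c) \<omega>" for \<omega> by simp
  then have eq: "emp k \<phi> \<omega> = emp k (\<lambda>x. \<phi> x - c) \<omega>" for \<omega>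
    using emp_add[of "\<lambda>x. \<phi> x - c" "\<lambda>_. c" C "\<bar>c\<bar>" k \<omega>] b emp_const[OF k] by simp
  show ?thesis
  proof (cases "C = 0")
    case True
    then have "(\<lambda>x. \<phi> x - c) = (\<lambda>_. 0)" using b by auto
    then show ?thesis using True unfolding eq by (simp add: emp_centered_def)
  next
    case False
    then have C: "C > 0" using b[of undefined] by simp
    have "(\<lambda>x. (1 / C) * (\<phi> x - c)) \<in> bdd1"
      using b C by (simp add: bdd1_def abs_mult)
    from emp_le_D(2)[OF this, of k] show ?thesis
      unfolding emp_cmult eq using C by (simp add: power_mult_distrib field_simps)
  qed
qed

lemma weighted_integrand_bound:
  assumes "\<And>x. \<bar>\<phi> x\<bar> \<le> C"
  shows "\<bar>w x * \<phi> x\<bar> \<le> supnorm w * C"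
  using assms[of x] w_nonneg[of x] w_le[of x] by (simp add: abs_mult mult_mono)

lemma emp_weight_square_le:
  assumes "0 < k"
  shows "(\<integral>\<omega>. (emp k w \<omega>)\<^sup>2 \<partial>M) \<le> (supnorm w)\<^sup>2 * D2 k / 4"
proof -
  have "\<bar>w x - supnorm w / 2\<bar> \<le> supnorm w / 2" for x
    using w_nonneg[of x] w_le[of x] unfolding abs_le_iff by linarith
  from emp_square_le[OF assms w_measurable this] show ?thesis
    by (simp add: power_divide)
qed

text \<open>Here \<rho> is any solution of the weighted equation, not necessarily the quotient; this
  covers vanishing weights, where every number is a solution. The change of measure turns
  \<open>\<pi>\<close> into \<open>\<pi>Y\<close> weighted by \<open>w\<close>, and \<open>w\<close>
  has mean one.\<close>

lemma emp_weighted_eq: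
  assumes "0 < k" "\<phi> \<in> borel_measurable borel" 
    and \<rho>: "\<rho> * (\<Sum>i=1..k. w (Y i \<omega>)) = (\<Sum>i=1..k. w (Y i \<omega>) * \<phi> (Y i \<omega>))"
  shows "\<rho> - (\<integral>x. \<phi> x \<partial>\<pi>) = emp k (\<lambda>x. w x * \<phi> x) \<omega> - \<rho> * emp k w \<omega>"
proof -
  have "(\<integral>x. w x \<partial>\<pi>Y) = 1"
    using integral_target_eq[of "\<lambda>_. 1"] prob_space.prob_space[OF p(4)] by simp
  then show ?thesis
    unfolding emp_centered_def \<rho>[symmetric] using integral_target_eq[OF assms(2)]
    by (simp add: algebra_simps)
qed

text \<open>
  Splitting \<open>w \<phi>\<close> into the nonnegative parts \<open>w (C \<plusminus> \<phi>) / 2\<close> gains the factor that makes the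
  bound match the coefficient of the second moment in \<^const>\<open>Bseq\<close>.
\<close>

lemma self_normalized_square_le:
  assumes k: "0 < k" and [measurable]: "\<phi> \<in> borel_measurable borel" "\<rho> \<in> borel_measurable M"
    and b: "\<And>x. \<bar>\<phi> x\<bar> \<le> C" "\<And>\<omega>. \<omega> \<in> space M \<Longrightarrow> \<bar>\<rho> \<omega>\<bar> \<le> C"
    and \<rho>: "\<And>\<omega>. \<omega> \<in> space M \<Longrightarrow>
      \<rho> \<omega> * (\<Sum>i=1..k. w (Y i \<omega>)) = (\<Sum>i=1..k. w (Y i \<omega>) * \<phi> (Y i \<omega>))"
  shows "(\<integral>\<omega>. (\<rho> \<omega> - (\<integral>x. \<phi> x \<partial>\<pi>))\<^sup>2 \<partial>M) \<le> 2 * (supnorm w)\<^sup>2 * C\<^sup>2 * D2 k"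
proof -
  have C0: "0 \<le> C" using b(1)[of undefined] by simp
  \<comment> \<open>Half the length of the interval from 0 to \<open>supnorm w * C\<close>, which
    contains both nonnegative integrands; \<open>emp_square_le\<close> is applied with its midpoint
    as centre.\<close>
  define s where "s = supnorm w * C / 2"
  have half: "\<bar>w x * ((C + r * \<phi> x) / 2) - s\<bar> \<le> s" if "\<bar>r\<bar> = 1" for x r
  proof -
    have r: "\<bar>r * \<phi> x\<bar> \<le> C" using b(1)[of x] that by (simp add: abs_mult)
    then have "0 \<le> w x * ((C + r * \<phi> x) / 2)" using w_nonneg[of x] by simp
    moreover have "w x * ((C + r * \<phi> x) / 2) \<le> supnorm w * C"
      using r w_nonneg[of x] w_le[of x] supnorm_w_nonneg C0 by (intro mult_mono) auto
    ultimately show ?thesis unfolding s_def abs_le_iff by linarith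
  qed
  define x where "x = emp k (\<lambda>x. w x * ((C + 1 * \<phi> x) / 2))"
  define y where "y = emp k (\<lambda>x. w x * ((C + (-1) * \<phi> x) / 2))"
  have bd: "\<bar>w x * ((C + r * \<phi> x) / 2)\<bar> \<le> 2 * s" if "\<bar>r\<bar> = 1" for x r
    using half[OF that, of x] by (simp add: abs_le_iff)
  have sq: "(\<integral>\<omega>. (x \<omega>)\<^sup>2 \<partial>M) \<le> s\<^sup>2 * D2 k" "(\<integral>\<omega>. (y \<omega>)\<^sup>2 \<partial>M) \<le> s\<^sup>2 * D2 k"
    unfolding x_def y_def by (rule emp_square_le[OF k _ half]; simp)+
  have int: "integrable M (\<lambda>\<omega>. (x \<omega>)\<^sup>2)" "integrable M (\<lambda>\<omega>. (y \<omega>)\<^sup>2)"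
    unfolding x_def y_def by (rule emp_integrable(2)[OF _ bd]; simp)+
  have xy: "x \<omega> + y \<omega> = C * emp k w \<omega>" "x \<omega> - y \<omega> = emp k (\<lambda>x. w x * \<phi> x) \<omega>" for \<omega>
  proof -
    have "x \<omega> + r * y \<omega> = emp k (\<lambda>x. w x * ((C + 1 * \<phi> x) / 2) + r * (w x * ((C + (-1) * \<phi> x) / 2))) \<omega>"
      if "\<bar>r\<bar> = 1" for r
    proof -
      have "\<bar>r * (w x * ((C + (-1) * \<phi> x) / 2))\<bar> \<le> 2 * s" for x
        using bd[of "-1" x] that by (simp add: abs_mult)
      then show ?thesis
        unfolding x_def y_def emp_cmult[symmetric]
        by (intro emp_add[symmetric, where C = "2 * s" and C' = "2 * s"] bd) simp_all
    qed
    from this[of 1] this[of "-1"] show "x \<omega> + y \<omega> = C * emp k w \<omega>"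
      "x \<omega> - y \<omega> = emp k (\<lambda>x. w x * \<phi> x) \<omega>"
      by (simp_all add: emp_cmult[symmetric] field_simps)
  qed
  have pt: "(\<rho> \<omega> - (\<integral>x. \<phi> x \<partial>\<pi>))\<^sup>2 \<le> 4 * (x \<omega>)\<^sup>2 + 4 * (y \<omega>)\<^sup>2" if \<omega>: "\<omega> \<in> space M" for \<omega>
  proof (cases "C = 0")
    case True
    with b have "\<phi> = (\<lambda>_. 0)" "\<rho> \<omega> = 0" using \<omega> by auto
    then show ?thesis by simp
  next
    case False
    with C0 have C: "C > 0" by simp
    \<comment> \<open>The barycentric coordinate of \<open>\<rho> \<omega>\<close> in the interval
      from \<open>-C\<close> to \<open>C\<close>. It turns the error into twice a convex combination
      of \<open>x \<omega>\<close> and \<open>- y \<omega>\<close>, so convexity of the square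
      applies.\<close>
    define l where "l = (C - \<rho> \<omega>) / (2 * C)"
    have l: "0 \<le> l" "l \<le> 1" using b(2)[OF \<omega>] C by (auto simp: l_def field_simps)
    have "\<rho> \<omega> = C * (1 - 2 * l)" using C by (simp add: l_def field_simps)
    then have "\<rho> \<omega> - (\<integral>x. \<phi> x \<partial>\<pi>) = (x \<omega> - y \<omega>) - (1 - 2 * l) * (x \<omega> + y \<omega>)"
      using emp_weighted_eq[OF k assms(2) \<rho>[OF \<omega>]] xy by simp
    also have "\<dots> = 2 * (l * x \<omega> + (1 - l) * (- y \<omega>))"
      by (simp add: algebra_simps)
    finally have "(\<rho> \<omega> - (\<integral>x. \<phi> x \<partial>\<pi>))\<^sup>2 = 4 * (l * x \<omega> + (1 - l) * (- y \<omega>))\<^sup>2"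
      by (simp only: power_mult_distrib) simp
    also have "(l * x \<omega> + (1 - l) * (- y \<omega>))\<^sup>2 \<le> l * (x \<omega>)\<^sup>2 + (1 - l) * (- y \<omega>)\<^sup>2"
    proof -
      have "l * (x \<omega>)\<^sup>2 + (1 - l) * (- y \<omega>)\<^sup>2 - (l * x \<omega> + (1 - l) * (- y \<omega>))\<^sup>2 = l * (1 - l) * (x \<omega> + y \<omega>)\<^sup>2"
        by (simp add: power2_eq_square algebra_simps)
      moreover have "0 \<le> l * (1 - l) * (x \<omega> + y \<omega>)\<^sup>2" using l by simp
      ultimately show ?thesis by linarith
    qed
    \<comment> \<open>The coordinate is random, so before integrating both weights are replaced by
      1. The final constant is \<open>8 * s\<^sup>2\<close>, which equals
      \<open>2 * (supnorm w)\<^sup>2 * C\<^sup>2\<close>.\<close>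
    also have "l * (x \<omega>)\<^sup>2 + (1 - l) * (- y \<omega>)\<^sup>2 \<le> 1 * (x \<omega>)\<^sup>2 + 1 * (y \<omega>)\<^sup>2"
      using l by (intro add_mono mult_mono) auto
    finally show ?thesis by simp
  qed
  have "(\<integral>\<omega>. (\<rho> \<omega> - (\<integral>x. \<phi> x \<partial>\<pi>))\<^sup>2 \<partial>M) \<le> (\<integral>\<omega>. 4 * (x \<omega>)\<^sup>2 + 4 * (y \<omega>)\<^sup>2 \<partial>M)"
    using int pt by (intro integral_mono') (auto)
  also have "\<dots> = 4 * (\<integral>\<omega>. (x \<omega>)\<^sup>2 \<partial>M) + 4 * (\<integral>\<omega>. (y \<omega>)\<^sup>2 \<partial>M)"
    using int by simp
  also have "\<dots> \<le> 4 * (s\<^sup>2 * D2 k) + 4 * (s\<^sup>2 * D2 k)"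
    using sq by linarith
  also have "\<dots> = 2 * (supnorm w)\<^sup>2 * C\<^sup>2 * D2 k"
    by (simp add: s_def power2_eq_square)
  finally show ?thesis .
qed

lemma Bseq_nonneg: "0 \<le> Bseq M \<pi>Y Y w k"
proof (cases "k \<le> 0")
  case False
  then have "Bseq M \<pi>Y Y w (int (nat k)) = supnorm w * D1 (nat k) + 2 * (supnorm w)\<^sup>2 * D2 (nat k)"
    by (intro Bseq_eq) simp
  then show ?thesis
    using False D_nonneg[of "nat k"] supnorm_w_nonneg by simp
qed (simp add: Bseq_def)

lemma D2_le_Bseq: "0 < k \<Longrightarrow> 2 * (supnorm w)\<^sup>2 * D2 k \<le> Bseq M \<pi>Y Y w (int k)"
  using D_nonneg[of k] supnorm_w_nonneg by (simp add: Bseq_eq)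

subsection \<open>The generated \<open>\<sigma>\<close>-algebras\<close>

lemma gen_subset_sets:
  "F_gen M X Y n \<subseteq> sets M" "(\<Union>k\<le>n. events_of M borel (Y k)) \<subseteq> sets M"
  "F_gen M X Y n \<union> events_of M (count_space UNIV) (Z k) \<subseteq> sets M"
  unfolding F_gen_def
  using events_of_subset_sets[OF process_measurable(1)] events_of_subset_sets[OF process_measurable(2)] events_of_subset_sets[OF process_measurable(3)]
  by blast+

lemma gen_subset_Pow:
  "F_gen M X Y n \<subseteq> Pow (space M)" "(\<Union>k\<le>n. events_of M borel (Y k)) \<subseteq> Pow (space M)"
  "F_gen M X Y n \<union> events_of M (count_space UNIV) (Z k) \<subseteq> Pow (space M)"
  using gen_subset_sets(1,2)[of n] gen_subset_sets(3)[of n k] sets.space_closed[of M] by blast+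

lemma subalgebra_M: "subalgebra M (\<F> n)" "subalgebra M (\<G> n)" "subalgebra M (\<H> n)"
  unfolding F_alg_def G_alg_def H_alg_def by (intro subalgebra_sigma gen_subset_sets)+

lemma subalgebra_F: "n \<le> m \<Longrightarrow> subalgebra (\<F> m) (\<F> n)"
  unfolding F_alg_def F_gen_def
  by (rule subalgebra_sigma_mono) (use gen_subset_Pow(1)[of m] in \<open>auto simp: F_gen_def dest: order_trans\<close>)

lemma subalgebra_F_G: "subalgebra (\<F> n) (\<G> n)"
  unfolding G_alg_def F_alg_def
  by (rule subalgebra_sigma_mono) (use gen_subset_Pow(1)[of n] in \<open>auto simp: F_gen_def\<close>)

lemma subalgebra_H_F: "subalgebra (\<H> n) (\<F> n)"
  unfolding H_alg_def F_alg_def diff_Suc_1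
  by (rule subalgebra_sigma_mono) (use gen_subset_Pow(3)[of n "Suc n"] in auto)

lemma adapted_measurable:
  "k \<le> n \<Longrightarrow> X k \<in> \<F> n \<rightarrow>\<^sub>M borel" "k \<le> n \<Longrightarrow> Y k \<in> \<F> n \<rightarrow>\<^sub>M borel"
  "k \<le> n \<Longrightarrow> Y k \<in> \<G> n \<rightarrow>\<^sub>M borel" "Z (Suc n) \<in> \<H> n \<rightarrow>\<^sub>M count_space UNIV"
proof -
  assume k: "k \<le> n"
  show "X k \<in> \<F> n \<rightarrow>\<^sub>M borel" "Y k \<in> \<F> n \<rightarrow>\<^sub>M borel"
    unfolding F_alg_def using k
    by (intro measurable_sigma_events gen_subset_Pow; auto simp: F_gen_def)+
  show "Y k \<in> \<G> n \<rightarrow>\<^sub>M borel"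
    unfolding G_alg_def using k by (intro measurable_sigma_events gen_subset_Pow) auto
next
  show "Z (Suc n) \<in> \<H> n \<rightarrow>\<^sub>M count_space UNIV"
    unfolding H_alg_def diff_Suc_1 by (intro measurable_sigma_events gen_subset_Pow) auto
qed

lemma theta_measurable:
  assumes "\<And>i. i \<le> k \<Longrightarrow> Y i \<in> N \<rightarrow>\<^sub>M borel" and g: "g \<in> borel_measurable borel"
  shows "\<theta> k g \<in> borel_measurable N"
proof -
  have [measurable]: "(\<lambda>\<omega>. w (Y i \<omega>)) \<in> borel_measurable N" "(\<lambda>\<omega>. g (Y i \<omega>)) \<in> borel_measurable N"
    if "i \<in> {1..k}" for i
    using measurable_compose[OF assms(1) w_measurable] measurable_compose[OF assms(1) g] that by auto
  show ?thesis
    unfolding theta_int_def by measurable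
qed

lemma \<delta>_measurable:
  assumes "\<And>i. i \<le> k \<Longrightarrow> Y i \<in> N \<rightarrow>\<^sub>M borel"
  shows "\<delta> k \<in> borel_measurable N"
proof -
  have [measurable]: "(\<lambda>\<omega>. w (Y i \<omega>)) \<in> borel_measurable N" if "i \<in> {1..k}" for i
    using measurable_compose[OF assms w_measurable] that by auto
  show ?thesis
    unfolding \<delta>_def theta_defined_def by measurable
qed

lemma \<zeta>_measurable: "Z k \<in> N \<rightarrow>\<^sub>M count_space UNIV \<Longrightarrow> \<zeta> k \<in> borel_measurable N"
  using measurable_compose[of "Z k" N "count_space UNIV" "\<lambda>b. if b then 1 else 0" borel]
  by (simp add: \<zeta>_def[abs_def])

lemma \<delta>_cases: "\<delta> k \<omega> = 0 \<or> \<delta> k \<omega> = 1" and \<delta>_bound: "\<bar>\<delta> k \<omega>\<bar> \<le> 1" "\<bar>1 - \<delta> k \<omega>\<bar> \<le> 1"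
  by (auto simp: \<delta>_def)

lemma \<zeta>_bound: "\<bar>\<zeta> k \<omega>\<bar> \<le> 1" "\<bar>1 - \<zeta> k \<omega>\<bar> \<le> 1"
  by (auto simp: \<zeta>_def)

lemma theta_bound:
  assumes "\<And>x. \<bar>g x\<bar> \<le> C"
  shows "\<bar>\<theta> k g \<omega>\<bar> \<le> C"
proof (cases "k = 0")
  case False
  define s where "s = (\<Sum>j=1..k. w (Y j \<omega>))"
  have s: "0 \<le> s" unfolding s_def by (intro sum_nonneg w_nonneg)
  have C: "0 \<le> C" using assms[of undefined] by simp
  have "\<bar>\<theta> k g \<omega>\<bar> \<le> (\<Sum>i=1..k. w (Y i \<omega>) / s * C)"
    unfolding theta_int_def s_def[symmetric] using False s w_nonneg assms
    by (auto simp: abs_mult intro!: order_trans[OF sum_abs] sum_mono divide_right_mono mult_left_mono)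
  \<comment> \<open>The quotient \<open>s / s\<close> is 1, or 0 if all weights vanish; the bound
    holds in both cases.\<close>
  also have "\<dots> = s / s * C"
    unfolding sum_distrib_right[symmetric] sum_divide_distrib[symmetric] s_def[symmetric] ..
  also have "\<dots> \<le> C" using C by (cases "s = 0") auto
  finally show ?thesis .
qed (simp add: theta_int_def assms)

lemma theta_mult_weights:
  assumes "0 < k" "\<delta> k \<omega> = 1"
  shows "\<theta> k g \<omega> * (\<Sum>i=1..k. w (Y i \<omega>)) = (\<Sum>i=1..k. w (Y i \<omega>) * g (Y i \<omega>))"
proof -
  define s where "s = (\<Sum>i=1..k. w (Y i \<omega>))"
  have "s > 0"
    using assms by (auto simp: s_def \<delta>_def theta_defined_def split: if_splits)
  then show ?thesis
    using assms(1) unfolding theta_int_def s_def[symmetric] by (simp add: sum_distrib_right)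
qed

lemma weights_eq_0:
  assumes "\<delta> k \<omega> = 0" "i \<in> {1..k}"
  shows "w (Y i \<omega>) = 0"
proof -
  have "(\<Sum>j=1..k. w (Y j \<omega>)) = 0"
    using assms(1) sum_nonneg[of "{1..k}" "\<lambda>j. w (Y j \<omega>)"] w_nonneg
    by (auto simp: \<delta>_def theta_defined_def split: if_splits)
  then show ?thesis
    using assms(2) w_nonneg by (subst (asm) sum_nonneg_eq_0_iff) auto
qed

text \<open>A sum of nonnegative weights stays positive once it is. Time 0 is excluded:
  \<open>\<delta> 0\<close> is 1 by convention, while \<open>\<delta> 1\<close> may be 0.\<close>

lemma \<delta>_mono:
  assumes "0 < k" "k \<le> j" "\<delta> k \<omega> = 1"
  shows "\<delta> j \<omega> = 1"
proof -
  have "0 < (\<Sum>i=1..k. w (Y i \<omega>))"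
    using assms by (auto simp: \<delta>_def theta_defined_def split: if_splits)
  also have "\<dots> \<le> (\<Sum>i=1..j. w (Y i \<omega>))"
    using assms w_nonneg by (intro sum_mono2) auto
  finally show ?thesis by (simp add: \<delta>_def theta_defined_def)
qed

subsection \<open>One step of the chain\<close>

text \<open>The transition rule tested against whatever is known once the coin is tossed. Only the
  resampling branch carries \<open>\<delta> k\<close>, since the rule says nothing when the weights
  vanish; the kernel branch is always specified.\<close>

lemma step_integrals:
  assumes V: "V \<in> borel_measurable (\<H> k)" "integrable M V"
    and g[measurable]: "g \<in> borel_measurable borel" and gb: "\<And>x. \<bar>g x\<bar> \<le> C"
  shows "(\<integral>\<omega>. V \<omega> * \<zeta> (Suc k) \<omega> * \<delta> k \<omega> * g (X (Suc k) \<omega>) \<partial>M)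
       = (\<integral>\<omega>. V \<omega> * \<zeta> (Suc k) \<omega> * \<delta> k \<omega> * \<theta> k g \<omega> \<partial>M)"
    and "(\<integral>\<omega>. V \<omega> * (1 - \<zeta> (Suc k) \<omega>) * g (X (Suc k) \<omega>) \<partial>M)
       = (\<integral>\<omega>. V \<omega> * (1 - \<zeta> (Suc k) \<omega>) * Pf g (X k \<omega>) \<partial>M)"
proof -
  let ?R = "real_cond_exp M (\<H> k) (\<lambda>\<omega>. g (X (Suc k) \<omega>))"
  have \<delta>H: "\<delta> k \<in> borel_measurable (\<H> k)"
    using measurable_from_subalg[OF subalgebra_H_F adapted_measurable(2)] by (rule \<delta>_measurable)
  have \<zeta>H: "\<zeta> (Suc k) \<in> borel_measurable (\<H> k)"
    by (rule \<zeta>_measurable[OF adapted_measurable(4)])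
  note [measurable] = V(1) \<delta>H \<zeta>H
  have [measurable]: "V \<in> borel_measurable M" "\<delta> k \<in> borel_measurable M" "\<zeta> (Suc k) \<in> borel_measurable M"
    using V(2) \<delta>_measurable[OF process_measurable(2)] \<zeta>_measurable[OF process_measurable(3)] by auto
  have [measurable]: "\<theta> k g \<in> borel_measurable M"
    by (rule theta_measurable) auto
  have [measurable]: "(\<lambda>\<omega>. Pf g (X k \<omega>)) \<in> borel_measurable M"
    using measurable_compose[OF process_measurable(1) Pf_measurable[OF g]] .
  have "bounded (range g)"
    using gb by (auto simp: bounded_iff)
  from X_step[rule_format, of "Suc k", OF _ g this]
  have R: "AE \<omega> in M. \<zeta> (Suc k) \<omega> * \<delta> k \<omega> * ?R \<omega> = \<zeta> (Suc k) \<omega> * \<delta> k \<omega> * \<theta> k g \<omega>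
      \<and> (1 - \<zeta> (Suc k) \<omega>) * ?R \<omega> = (1 - \<zeta> (Suc k) \<omega>) * Pf g (X k \<omega>)"
    by (auto simp: \<zeta>_def \<delta>_def Pf_def elim!: eventually_mono)
  have "integrable M (\<lambda>\<omega>. V \<omega> * (\<zeta> (Suc k) \<omega> * \<delta> k \<omega>))"
    by (rule integrable_mult_bounded[OF V(2), where C = 1])
      (use \<zeta>_bound \<delta>_bound in \<open>auto simp: abs_mult mult_le_one\<close>)
  then have "(\<integral>\<omega>. V \<omega> * \<zeta> (Suc k) \<omega> * \<delta> k \<omega> * g (X (Suc k) \<omega>) \<partial>M)
      = (\<integral>\<omega>. V \<omega> * \<zeta> (Suc k) \<omega> * \<delta> k \<omega> * ?R \<omega> \<partial>M)"
    by (intro real_cond_exp_integral_mult[OF prob_space_axioms subalgebra_M(3), where C = C])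
      (use gb in \<open>auto simp: mult.assoc\<close>)
  also have "\<dots> = (\<integral>\<omega>. V \<omega> * \<zeta> (Suc k) \<omega> * \<delta> k \<omega> * \<theta> k g \<omega> \<partial>M)"
  proof (rule integral_cong_AE)
    show "AE \<omega> in M. V \<omega> * \<zeta> (Suc k) \<omega> * \<delta> k \<omega> * ?R \<omega> = V \<omega> * \<zeta> (Suc k) \<omega> * \<delta> k \<omega> * \<theta> k g \<omega>"
      using R by eventually_elim (simp only: mult.assoc)
  qed auto
  finally show "(\<integral>\<omega>. V \<omega> * \<zeta> (Suc k) \<omega> * \<delta> k \<omega> * g (X (Suc k) \<omega>) \<partial>M)
       = (\<integral>\<omega>. V \<omega> * \<zeta> (Suc k) \<omega> * \<delta> k \<omega> * \<theta> k g \<omega> \<partial>M)" .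
  have "integrable M (\<lambda>\<omega>. V \<omega> * (1 - \<zeta> (Suc k) \<omega>))"
    by (rule integrable_mult_bounded[OF V(2), where C = 1]) (use \<zeta>_bound in auto)
  then have "(\<integral>\<omega>. V \<omega> * (1 - \<zeta> (Suc k) \<omega>) * g (X (Suc k) \<omega>) \<partial>M)
      = (\<integral>\<omega>. V \<omega> * (1 - \<zeta> (Suc k) \<omega>) * ?R \<omega> \<partial>M)"
    by (intro real_cond_exp_integral_mult[OF prob_space_axioms subalgebra_M(3), where C = C])
      (use gb in auto)
  also have "\<dots> = (\<integral>\<omega>. V \<omega> * (1 - \<zeta> (Suc k) \<omega>) * Pf g (X k \<omega>) \<partial>M)"
  proof (rule integral_cong_AE)
    show "AE \<omega> in M. V \<omega> * (1 - \<zeta> (Suc k) \<omega>) * ?R \<omega> = V \<omega> * (1 - \<zeta> (Suc k) \<omega>) * Pf g (X k \<omega>)"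
      using R by eventually_elim (simp only: mult.assoc)
  qed auto
  finally show "(\<integral>\<omega>. V \<omega> * (1 - \<zeta> (Suc k) \<omega>) * g (X (Suc k) \<omega>) \<partial>M)
       = (\<integral>\<omega>. V \<omega> * (1 - \<zeta> (Suc k) \<omega>) * Pf g (X k \<omega>) \<partial>M)" .
qed

text \<open>By independence the conditional mean of the coin given \<open>\<F> k\<close> is the
  constant \<epsilon>. The multiplier must be known before the new state is drawn, which restricts
  where the coin can be averaged out.\<close>

lemma integral_\<zeta>_mult:
  assumes V: "V \<in> borel_measurable (\<F> k)" "integrable M V"
  shows "(\<integral>\<omega>. V \<omega> * \<zeta> (Suc k) \<omega> \<partial>M) = \<epsilon> * (\<integral>\<omega>. V \<omega> \<partial>M)"
proof -
  interpret \<F>: sigma_finite_subalgebra M "\<F> k"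
    by (intro finite_measure_subalgebra_is_sigma_finite finite_measure_subalgebra.intro
        finite_measure_subalgebra_axioms.intro finite_measure_axioms subalgebra_M)
  have [measurable]: "\<zeta> (Suc k) \<in> borel_measurable M"
    by (rule \<zeta>_measurable) simp
  let ?Z = "{\<omega> \<in> space M. Z (Suc k) \<omega>}"
  have "?Z = Z (Suc k) -` {True} \<inter> space M" by auto
  then have Z: "?Z \<in> events_of M (count_space UNIV) (Z (Suc k))"
    unfolding events_of_def by (intro CollectI exI[of _ "{True}"]) simp
  have "AE \<omega> in M. real_cond_exp M (\<F> k) (\<zeta> (Suc k)) \<omega> = \<epsilon>"
  proof (rule \<F>.real_cond_exp_charact)
    fix A assume "A \<in> sets (\<F> k)"
    then have A: "A \<in> sigma_sets (space M) (F_gen M X Y k \<union> (\<Union>k. events_of M borel (Y k)))"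
      and AM[measurable]: "A \<in> sets M"
      using subalgebra_M(1)[of k] gen_subset_Pow(1)[of k]
        sigma_sets_mono'[OF Un_upper1, of "space M" "F_gen M X Y k" "\<Union>k. events_of M borel (Y k)"]
      by (auto simp: F_alg_def subalgebra_def)
    have "prob (?Z \<inter> A) = prob ?Z * prob A"
      using Z_indep[rule_format, of "Suc k"] by (intro indep_setD[OF _ Z]) (use A in auto)
    moreover have "(\<integral>\<omega>. indicator A \<omega> * \<zeta> (Suc k) \<omega> \<partial>M) = prob (?Z \<inter> A)"
    proof -
      have "(\<integral>\<omega>. indicator A \<omega> * \<zeta> (Suc k) \<omega> \<partial>M) = (\<integral>\<omega>. indicator (?Z \<inter> A) \<omega> \<partial>M)"
        by (intro Bochner_Integration.integral_cong) (auto simp: \<zeta>_def split: split_indicator)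
      then show ?thesis by simp
    qed
    ultimately show "(\<integral>\<omega>\<in>A. \<zeta> (Suc k) \<omega> \<partial>M) = (\<integral>\<omega>\<in>A. \<epsilon> \<partial>M)"
      using Z_bern[rule_format, of "Suc k"] by (simp add: set_lebesgue_integral_def)
  qed (auto intro!: integrable_const_bound[where B = 1] simp: \<zeta>_bound)
  then have "(\<integral>\<omega>. V \<omega> * real_cond_exp M (\<F> k) (\<zeta> (Suc k)) \<omega> \<partial>M) = (\<integral>\<omega>. V \<omega> * \<epsilon> \<partial>M)"
    using V(2) by (intro integral_cong_AE) auto
  with real_cond_exp_integral_mult(2)[OF prob_space_axioms subalgebra_M(1) V, of "\<zeta> (Suc k)" 1] \<zeta>_bound(1)
  show ?thesis by simp
qed

lemma kernel_step_integral:
  assumes g[measurable]: "g \<in> borel_measurable borel" and gb: "\<And>x. \<bar>g x\<bar> \<le> C"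
  shows "(\<integral>\<omega>. (1 - \<zeta> (Suc k) \<omega>) * g (X (Suc k) \<omega>) \<partial>M) = (1 - \<epsilon>) * (\<integral>\<omega>. Pf g (X k \<omega>) \<partial>M)"
proof -
  have F: "(\<lambda>\<omega>. Pf g (X k \<omega>)) \<in> borel_measurable (\<F> k)"
    using measurable_compose[OF adapted_measurable(1) Pf_measurable[OF g]] by simp
  have M [measurable]: "(\<lambda>\<omega>. Pf g (X k \<omega>)) \<in> borel_measurable M"
    using measurable_from_subalg[OF subalgebra_M(1) F] .
  have [measurable]: "\<zeta> (Suc k) \<in> borel_measurable M"
    by (rule \<zeta>_measurable) simp
  have int: "integrable M (\<lambda>\<omega>. Pf g (X k \<omega>))"
    by (rule integrable_const_bound[where B = C]) (use Pf_bound[OF g gb] in auto)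
  have "integrable M (\<lambda>\<omega>. Pf g (X k \<omega>) * \<zeta> (Suc k) \<omega>)"
    by (rule integrable_mult_bounded[OF int, where C = 1]) (auto simp: \<zeta>_bound)
  with int have "(\<integral>\<omega>. Pf g (X k \<omega>) - Pf g (X k \<omega>) * \<zeta> (Suc k) \<omega> \<partial>M) = (1 - \<epsilon>) * (\<integral>\<omega>. Pf g (X k \<omega>) \<partial>M)"
    by (simp add: integral_\<zeta>_mult[OF F int] left_diff_distrib)
  moreover have "(\<integral>\<omega>. (1 - \<zeta> (Suc k) \<omega>) * g (X (Suc k) \<omega>) \<partial>M) = (\<integral>\<omega>. (1 - \<zeta> (Suc k) \<omega>) * Pf g (X k \<omega>) \<partial>M)"
    using step_integrals(2)[OF borel_measurable_const integrable_const g gb, of 1 k] unfolding mult_1 .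
  moreover have "(1 - \<zeta> (Suc k) \<omega>) * Pf g (X k \<omega>) = Pf g (X k \<omega>) - Pf g (X k \<omega>) * \<zeta> (Suc k) \<omega>" for \<omega>
    by (simp add: algebra_simps)
  ultimately show ?thesis by simp
qed

text \<open>The factor \<open>\<delta> k\<close> switches the innovation off while all weights vanish: the conditional law of
  the new state is then unspecified.\<close>

definition innovation :: "('a \<Rightarrow> real) \<Rightarrow> nat \<Rightarrow> 'w \<Rightarrow> real" where
  "innovation g k \<omega> = \<delta> k \<omega> * (g (X (Suc k) \<omega>) - (1 - \<epsilon>) * Pf g (X k \<omega>) - \<epsilon> * \<theta> k g \<omega>)"

lemma innovation_measurable:
  assumes g: "g \<in> borel_measurable borel"
  shows "innovation g k \<in> borel_measurable (\<F> (Suc k))" "innovation g k \<in> borel_measurable M"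
proof -
  have [measurable]: "(\<lambda>\<omega>. Pf g (X k \<omega>)) \<in> borel_measurable (\<F> (Suc k))"
    using measurable_compose[OF adapted_measurable(1) Pf_measurable[OF g]] by simp
  have [measurable]: "(\<lambda>\<omega>. g (X (Suc k) \<omega>)) \<in> borel_measurable (\<F> (Suc k))"
    using measurable_compose[OF adapted_measurable(1) g] by simp
  have [measurable]: "\<delta> k \<in> borel_measurable (\<F> (Suc k))" "\<theta> k g \<in> borel_measurable (\<F> (Suc k))"
    by (auto intro!: \<delta>_measurable theta_measurable adapted_measurable g)
  show F: "innovation g k \<in> borel_measurable (\<F> (Suc k))"
    unfolding innovation_def by measurable
  show "innovation g k \<in> borel_measurable M"
    by (rule measurable_from_subalg[OF subalgebra_M(1) F])
qed

lemma innovation_bound: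
  assumes g: "g \<in> borel_measurable borel" and gb: "\<And>x. \<bar>g x\<bar> \<le> C"
  shows "\<bar>innovation g k \<omega>\<bar> \<le> 2 * C"
proof -
  have "\<bar>(1 - \<epsilon>) * Pf g (X k \<omega>)\<bar> \<le> (1 - \<epsilon>) * C"
    using Pf_bound[OF g gb] eps by (auto simp: abs_mult intro!: mult_left_mono)
  moreover have "\<bar>\<epsilon> * \<theta> k g \<omega>\<bar> \<le> \<epsilon> * C"
    using theta_bound[of g C, OF gb] eps by (auto simp: abs_mult intro!: mult_left_mono)
  ultimately have "\<bar>g (X (Suc k) \<omega>) - (1 - \<epsilon>) * Pf g (X k \<omega>) - \<epsilon> * \<theta> k g \<omega>\<bar> \<le> 2 * C"
    using gb[of "X (Suc k) \<omega>"] by (simp add: algebra_simps)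
  moreover have "0 \<le> C" using gb[of undefined] by simp
  ultimately show ?thesis
    using \<delta>_cases[of k \<omega>] by (auto simp: innovation_def)
qed

text \<open>Where \<open>\<delta> k\<close> is 1, the subtracted terms form the conditional mean of
  \<open>g (X (Suc k) \<omega>)\<close> given \<open>\<F> k\<close>. The transition rule conditions
  on the coin as well, so the two branches have to be averaged.\<close>

lemma innovation_orthogonal_past:
  assumes g[measurable]: "g \<in> borel_measurable borel" and gb: "\<And>x. \<bar>g x\<bar> \<le> C"
    and V: "V \<in> borel_measurable (\<F> k)" "integrable M V"
  shows "(\<integral>\<omega>. innovation g k \<omega> * V \<omega> \<partial>M) = 0"
proof -
  have Pm: "(\<lambda>\<omega>. Pf g (X k \<omega>)) \<in> borel_measurable (\<F> k)"
    using measurable_compose[OF adapted_measurable(1) Pf_measurable[OF g]] by simp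
  have tm: "\<theta> k g \<in> borel_measurable (\<F> k)"
    by (auto intro!: theta_measurable adapted_measurable g)
  have dm: "\<delta> k \<in> borel_measurable (\<F> k)"
    by (auto intro!: \<delta>_measurable adapted_measurable)
  note bounds = Pf_bound[OF g gb] theta_bound[of g C, OF gb] \<zeta>_bound gb
  note [measurable] = measurable_from_subalg[OF subalgebra_M(1) Pm] measurable_from_subalg[OF subalgebra_M(1) tm]
    measurable_from_subalg[OF subalgebra_M(1) dm] \<zeta>_measurable[OF process_measurable(3)]
  have int: "integrable M (\<lambda>\<omega>. V \<omega> * \<delta> k \<omega>)"
    by (rule integrable_mult_bounded[OF V(2), where C = 1]) (auto simp: \<delta>_bound)
  have VF: "(\<lambda>\<omega>. V \<omega> * \<delta> k \<omega>) \<in> borel_measurable (\<F> k)"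
    using V(1) dm by measurable
  have VH: "(\<lambda>\<omega>. V \<omega> * \<delta> k \<omega>) \<in> borel_measurable (\<H> k)" "V \<in> borel_measurable (\<H> k)"
    using measurable_from_subalg[OF subalgebra_H_F] VF V(1) by blast+
  have intP: "integrable M (\<lambda>\<omega>. V \<omega> * \<delta> k \<omega> * Pf g (X k \<omega>))"
    and intT: "integrable M (\<lambda>\<omega>. V \<omega> * \<delta> k \<omega> * \<theta> k g \<omega>)"
    and intg: "integrable M (\<lambda>\<omega>. V \<omega> * \<delta> k \<omega> * g (X (Suc k) \<omega>))"
    by (rule integrable_mult_bounded[OF int, where C = C]; use bounds in auto)+
  have intz: "integrable M (\<lambda>\<omega>. V \<omega> * \<delta> k \<omega> * g (X (Suc k) \<omega>) * \<zeta> (Suc k) \<omega>)"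
    "integrable M (\<lambda>\<omega>. V \<omega> * \<delta> k \<omega> * Pf g (X k \<omega>) * \<zeta> (Suc k) \<omega>)"
    by (rule integrable_mult_bounded[OF intg, where C = 1] integrable_mult_bounded[OF intP, where C = 1];
        use bounds in auto)+
  have VT: "(\<lambda>\<omega>. V \<omega> * \<delta> k \<omega> * \<theta> k g \<omega>) \<in> borel_measurable (\<F> k)"
    using VF tm by (rule borel_measurable_times)
  \<comment> \<open>The order matters: the coin is independent of \<open>\<F> k\<close> but
    influences the new state. So the new state is replaced by the resampling average first, and the
    coin by its mean afterwards.\<close>
  have "(\<integral>\<omega>. V \<omega> * \<delta> k \<omega> * g (X (Suc k) \<omega>) * \<zeta> (Suc k) \<omega> \<partial>M)
      = \<epsilon> * (\<integral>\<omega>. V \<omega> * \<delta> k \<omega> * \<theta> k g \<omega> \<partial>M)"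
    using step_integrals(1)[OF VH(2) V(2) g gb] integral_\<zeta>_mult[OF VT intT]
    by (simp add: mult_ac)
  moreover have "(\<integral>\<omega>. V \<omega> * \<delta> k \<omega> * g (X (Suc k) \<omega>) \<partial>M)
      - (\<integral>\<omega>. V \<omega> * \<delta> k \<omega> * g (X (Suc k) \<omega>) * \<zeta> (Suc k) \<omega> \<partial>M)
      = (1 - \<epsilon>) * (\<integral>\<omega>. V \<omega> * \<delta> k \<omega> * Pf g (X k \<omega>) \<partial>M)"
  proof -
    have "(\<integral>\<omega>. V \<omega> * \<delta> k \<omega> * Pf g (X k \<omega>) * \<zeta> (Suc k) \<omega> \<partial>M)
        = \<epsilon> * (\<integral>\<omega>. V \<omega> * \<delta> k \<omega> * Pf g (X k \<omega>) \<partial>M)"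
      using borel_measurable_times[OF VF Pm] intP by (rule integral_\<zeta>_mult)
    moreover have "V \<omega> * \<delta> k \<omega> * (1 - \<zeta> (Suc k) \<omega>) * a
        = V \<omega> * \<delta> k \<omega> * a - V \<omega> * \<delta> k \<omega> * a * \<zeta> (Suc k) \<omega>" for \<omega> a
      by (simp add: algebra_simps)
    ultimately show ?thesis
      using step_integrals(2)[OF VH(1) int g gb] intP intg intz
      by (simp add: algebra_simps)
  qed
  ultimately have "(\<integral>\<omega>. V \<omega> * \<delta> k \<omega> * g (X (Suc k) \<omega>) \<partial>M)
      = (1 - \<epsilon>) * (\<integral>\<omega>. V \<omega> * \<delta> k \<omega> * Pf g (X k \<omega>) \<partial>M) + \<epsilon> * (\<integral>\<omega>. V \<omega> * \<delta> k \<omega> * \<theta> k g \<omega> \<partial>M)"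
    by simp
  moreover have "innovation g k \<omega> * V \<omega> = V \<omega> * \<delta> k \<omega> * g (X (Suc k) \<omega>)
      - (1 - \<epsilon>) * (V \<omega> * \<delta> k \<omega> * Pf g (X k \<omega>)) - \<epsilon> * (V \<omega> * \<delta> k \<omega> * \<theta> k g \<omega>)" for \<omega>
    by (simp add: innovation_def algebra_simps)
  ultimately show ?thesis
    using intP intT intg by simp
qed


lemma integrable_bounded:
  fixes g :: "'w \<Rightarrow> real"
  assumes "g \<in> borel_measurable M" "\<And>\<omega>. \<bar>g \<omega>\<bar> \<le> C"
  shows "integrable M g"
  by (rule integrable_const_bound[where B = C]) (use assms in auto)

text \<open>
  Given the past, the auxiliary process evolves independently of the chain. Hence the innovations,
  though not adapted to the auxiliary process, are orthogonal to its whole future.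
\<close>

lemma innovation_orthogonal_auxiliary:
  assumes g[measurable]: "g \<in> borel_measurable borel" and gb: "\<And>x. \<bar>g x\<bar> \<le> C"
    and "k \<le> j" "V \<in> borel_measurable (\<G> j)" "integrable M V"
  shows "(\<integral>\<omega>. innovation g k \<omega> * V \<omega> \<partial>M) = 0"
  using assms(3-5)
proof (induction j arbitrary: V rule: dec_induct)
  case base
  then show ?case
    using measurable_from_subalg[OF subalgebra_F_G] innovation_orthogonal_past[OF g gb] by blast
next
  case (step j)
  note dM[measurable] = innovation_measurable(2)[OF g, of k]
  have db: "\<bar>innovation g k \<omega>\<bar> \<le> 2 * C" for \<omega>
    by (rule innovation_bound[OF g gb])
  note d_int = integrable_bounded[OF dM db]
  \<comment> \<open>Rectangles of an event known at time j and an event of \<open>Y (Suc j)\<close>: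
    an intersection-stable generator of \<open>\<G> (Suc j)\<close>, on which one conditioning step
    suffices.\<close>
  define gen where "gen = {A \<inter> (Y (Suc j) -` S \<inter> space M) | A S. A \<in> sets (\<G> j) \<and> S \<in> sets borel}"
  have spG: "space (\<G> i) = space M" and setsG: "sets (\<G> i) \<subseteq> sets M" for i
    using subalgebra_M(2)[of i] by (auto simp: subalgebra_def)
  have setsF: "sets (\<F> i) \<subseteq> sets M" for i
    using subalgebra_M(1)[of i] by (auto simp: subalgebra_def)
  have top: "space M \<in> sets (\<G> j)"
    using sets.top[of "\<G> j"] by (simp add: spG)
  have gen_sets: "gen \<subseteq> sets M"
    unfolding gen_def using setsG[of j] measurable_sets[OF process_measurable(2)[of "Suc j"]]
    by (blast intro: sets.Int)
  have rectangle: "(\<integral>\<omega>. innovation g k \<omega> * indicator A \<omega> * indicator S (Y (Suc j) \<omega>) \<partial>M) = 0"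
    if A: "A \<in> sets (\<G> j)" and S[measurable]: "S \<in> sets borel" for A S
  proof -
    have AF: "A \<in> sets (\<F> j)" using subalgebra_F_G A by (auto simp: subalgebra_def)
    have AM[measurable]: "A \<in> sets M" using A setsG by auto
    let ?h = "\<lambda>\<omega>. indicator S (Y (Suc j) \<omega>) :: real"
    have hb: "bounded (range (indicator S :: 'a \<Rightarrow> real))"
      by (auto simp: bounded_iff intro!: exI[of _ 1] split: split_indicator)
    have h1: "\<bar>?h \<omega>\<bar> \<le> 1" for \<omega> by (auto split: split_indicator)
    have hM: "?h \<in> borel_measurable M" by measurable
    have h_int: "integrable M ?h"
      using hM h1 by (rule integrable_bounded)
    let ?EF = "real_cond_exp M (\<F> j) ?h" and ?EG = "real_cond_exp M (\<G> j) ?h"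
    note cond_mult = real_cond_exp_integral_mult[OF prob_space_axioms]
    interpret F: sigma_finite_subalgebra M "\<F> j"
      by (intro finite_measure_subalgebra_is_sigma_finite finite_measure_subalgebra.intro
          finite_measure_subalgebra_axioms.intro finite_measure_axioms subalgebra_M)
    have A_int: "integrable M (indicator A :: _ \<Rightarrow> real)"
      by (rule integrable_bounded[where C = 1]) (auto split: split_indicator)
    have dA_int: "integrable M (\<lambda>\<omega>. innovation g k \<omega> * indicator A \<omega>)"
      by (rule integrable_mult_bounded[OF d_int, where C = 1]) (auto split: split_indicator)
    show ?thesis
    proof (cases "j = k")
      case False
      \<comment> \<open>Here the innovation is already known at time j. The hypothesis on the
        auxiliary process replaces conditioning on \<open>\<F> j\<close> by conditioning on
        \<open>\<G> j\<close>, which leaves a functional of \<open>Y\<close> up to time j.\<close>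
      then have "Suc k \<le> j" using step.hyps by simp
      have "(\<lambda>\<omega>. innovation g k \<omega> * indicator A \<omega>) \<in> borel_measurable (\<F> j)"
        using measurable_from_subalg[OF subalgebra_F[OF \<open>Suc k \<le> j\<close>] innovation_measurable(1)[OF g]] AF
        by measurable
      from cond_mult(2)[OF subalgebra_M(1) this dA_int hM h1]
      have "(\<integral>\<omega>. innovation g k \<omega> * indicator A \<omega> * ?h \<omega> \<partial>M)
          = (\<integral>\<omega>. innovation g k \<omega> * indicator A \<omega> * ?EF \<omega> \<partial>M)" .
      also have "\<dots> = (\<integral>\<omega>. innovation g k \<omega> * indicator A \<omega> * ?EG \<omega> \<partial>M)"
        using Y_aux[rule_format, OF _ hb, of j] by (intro integral_cong_AE) auto
      also have "\<dots> = (\<integral>\<omega>. innovation g k \<omega> * (indicator A \<omega> * ?EG \<omega>) \<partial>M)"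
        by (simp only: mult.assoc)
      also have "\<dots> = 0"
      proof (rule step.IH)
        show "(\<lambda>\<omega>. indicator A \<omega> * ?EG \<omega>) \<in> borel_measurable (\<G> j)"
          using A by measurable
        show "integrable M (\<lambda>\<omega>. indicator A \<omega> * ?EG \<omega>)"
          using A by (intro cond_mult(1)[OF subalgebra_M(2) _ A_int hM h1]) auto
      qed
      finally show ?thesis .
    next
      case True
      \<comment> \<open>At \<open>j = k\<close> the innovation contains \<open>X (Suc k)\<close> and
        is not \<open>\<F> k\<close>-measurable. Conditional independence of
        \<open>X (Suc k)\<close> and \<open>Y (Suc k)\<close> lets the indicator of
        \<open>Y (Suc k)\<close> be replaced by its conditional expectation, and orthogonality to
        the past finishes.\<close>
      let ?c = "\<lambda>\<omega>. (1 - \<epsilon>) * Pf g (X k \<omega>) + \<epsilon> * \<theta> k g \<omega>"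
      let ?g = "\<lambda>\<omega>. g (X (Suc k) \<omega>)"
      let ?V = "\<lambda>\<omega>. \<delta> k \<omega> * indicator A \<omega>"
      have gM: "?g \<in> borel_measurable M" by measurable
      have bg: "bounded (range g)" using gb by (auto simp: bounded_iff)
      have [measurable]: "\<delta> k \<in> borel_measurable (\<F> j)" "?c \<in> borel_measurable (\<F> j)" "A \<in> sets (\<F> j)"
        using True AF measurable_compose[OF adapted_measurable(1) Pf_measurable[OF g], of k j]
        by (auto intro!: \<delta>_measurable theta_measurable[OF _ g] adapted_measurable borel_measurable_add borel_measurable_times)
      have cb: "\<bar>?c \<omega>\<bar> \<le> C" for \<omega>
      proof -
        have "\<bar>?c \<omega>\<bar> \<le> (1 - \<epsilon>) * C + \<epsilon> * C"
          using Pf_bound[OF g gb] theta_bound[of g C, OF gb] eps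
          by (intro order_trans[OF abs_triangle_ineq add_mono]) (auto simp: abs_mult intro!: mult_left_mono)
        then show ?thesis by (simp add: algebra_simps)
      qed
      have VF: "?V \<in> borel_measurable (\<F> j)" by measurable
      have VM: "?V \<in> borel_measurable M" by (rule measurable_from_subalg[OF subalgebra_M(1) VF])
      have V_int: "integrable M ?V"
        using VM \<delta>_bound(1) by (intro integrable_bounded[where C = 1]) (auto simp: abs_mult split: split_indicator)
      note Vh = cond_mult[OF subalgebra_M(1) VF V_int hM h1]
      have VEF: "(\<lambda>\<omega>. ?V \<omega> * ?EF \<omega>) \<in> borel_measurable (\<F> j)" by measurable
      have cM: "?c \<in> borel_measurable M" by (rule measurable_from_subalg[OF subalgebra_M(1)]) measurable
      have Vc: "integrable M (\<lambda>\<omega>. ?V \<omega> * ?c \<omega>)"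
        by (rule integrable_mult_bounded[OF V_int cM cb])
      have VcF: "(\<lambda>\<omega>. ?V \<omega> * ?c \<omega>) \<in> borel_measurable (\<F> j)" by measurable
      have gh: "(\<lambda>\<omega>. ?g \<omega> * ?h \<omega>) \<in> borel_measurable M" by measurable
      have ghb: "\<bar>?g \<omega> * ?h \<omega>\<bar> \<le> C" for \<omega>
        using gb[of "X (Suc k) \<omega>"] by (auto simp: abs_mult split: split_indicator)
      have "(\<integral>\<omega>. ?V \<omega> * (?g \<omega> * ?h \<omega>) \<partial>M)
          = (\<integral>\<omega>. ?V \<omega> * real_cond_exp M (\<F> j) (\<lambda>\<omega>. ?g \<omega> * ?h \<omega>) \<omega> \<partial>M)"
        by (rule cond_mult(2)[OF subalgebra_M(1) VF V_int gh ghb])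
      also have "\<dots> = (\<integral>\<omega>. (?V \<omega> * ?EF \<omega>) * real_cond_exp M (\<F> j) ?g \<omega> \<partial>M)"
      proof (rule integral_cong_AE)
        have "AE \<omega> in M. real_cond_exp M (\<F> j) (\<lambda>\<omega>. ?g \<omega> * ?h \<omega>) \<omega> = real_cond_exp M (\<F> j) ?g \<omega> * ?EF \<omega>"
          using cond_indep[rule_format, of "Suc j" g "indicator S", OF _ g bg _ hb] True by simp
        then show "AE \<omega> in M. ?V \<omega> * real_cond_exp M (\<F> j) (\<lambda>\<omega>. ?g \<omega> * ?h \<omega>) \<omega>
            = (?V \<omega> * ?EF \<omega>) * real_cond_exp M (\<F> j) ?g \<omega>"
          by eventually_elim simp
      qed (use VM in measurable)
      also have "\<dots> = (\<integral>\<omega>. (?V \<omega> * ?EF \<omega>) * ?g \<omega> \<partial>M)"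
        by (rule cond_mult(2)[OF subalgebra_M(1) VEF Vh(1) gM gb, symmetric])
      finally have 1: "(\<integral>\<omega>. ?V \<omega> * (?g \<omega> * ?h \<omega>) \<partial>M) = (\<integral>\<omega>. (?V \<omega> * ?EF \<omega>) * ?g \<omega> \<partial>M)" .
      have 2: "(\<integral>\<omega>. (?V \<omega> * ?c \<omega>) * ?h \<omega> \<partial>M) = (\<integral>\<omega>. (?V \<omega> * ?EF \<omega>) * ?c \<omega> \<partial>M)"
        using cond_mult(2)[OF subalgebra_M(1) VcF Vc hM h1] by (simp add: mult_ac)
      have EF_int: "integrable M (\<lambda>\<omega>. indicator A \<omega> * ?EF \<omega>)"
        by (intro cond_mult(1)[OF subalgebra_M(1) _ A_int hM h1]) auto
      have AEF: "(\<lambda>\<omega>. indicator A \<omega> * ?EF \<omega>) \<in> borel_measurable (\<F> j)" by measurable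
      have "(\<integral>\<omega>. innovation g k \<omega> * (indicator A \<omega> * ?EF \<omega>) \<partial>M) = 0"
        using True EF_int AEF by (intro innovation_orthogonal_past[OF g gb]) simp_all
      moreover have "innovation g k \<omega> * (indicator A \<omega> * ?EF \<omega>)
          = (?V \<omega> * ?EF \<omega>) * ?g \<omega> - (?V \<omega> * ?EF \<omega>) * ?c \<omega>" for \<omega>
        by (simp add: innovation_def algebra_simps)
      ultimately have "(\<integral>\<omega>. (?V \<omega> * ?EF \<omega>) * ?g \<omega> \<partial>M) - (\<integral>\<omega>. (?V \<omega> * ?EF \<omega>) * ?c \<omega> \<partial>M) = 0"
        using integrable_mult_bounded[OF Vh(1) gM gb] integrable_mult_bounded[OF Vh(1) cM cb] by simp
      then have "(\<integral>\<omega>. ?V \<omega> * (?g \<omega> * ?h \<omega>) \<partial>M) - (\<integral>\<omega>. (?V \<omega> * ?c \<omega>) * ?h \<omega> \<partial>M) = 0"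
        by (simp only: 1 2)
      moreover have "innovation g k \<omega> * indicator A \<omega> * ?h \<omega>
          = ?V \<omega> * (?g \<omega> * ?h \<omega>) - (?V \<omega> * ?c \<omega>) * ?h \<omega>" for \<omega>
        by (simp add: innovation_def algebra_simps)
      ultimately show ?thesis
        using integrable_mult_bounded[OF V_int gh ghb] integrable_mult_bounded[OF Vc hM h1] by simp
    qed
  qed
  have generates: "sets (\<G> (Suc j)) \<subseteq> sigma_sets (space M) gen"
  proof -
    have "events_of M borel (Y i) \<subseteq> gen" if "i \<le> Suc j" for i
    proof
      fix A assume "A \<in> events_of M borel (Y i)"
      then obtain S where S: "A = Y i -` S \<inter> space M" "S \<in> sets borel"
        by (auto simp: events_of_def)
      show "A \<in> gen"
      proof (cases "i = Suc j")
        case True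
        then show ?thesis
          unfolding gen_def using S top by (intro CollectI exI[of _ "space M"] exI[of _ S]) auto
      next
        case False
        then have "A \<in> sets (\<G> j)"
          using that S measurable_sets[OF adapted_measurable(3), of i j S] by (simp add: spG)
        then show ?thesis
          unfolding gen_def using S by (intro CollectI exI[of _ A] exI[of _ UNIV]) auto
      qed
    qed
    then have "(\<Union>i\<le>Suc j. events_of M borel (Y i)) \<subseteq> gen" by blast
    from sigma_sets_mono'[OF this] show ?thesis
      unfolding G_alg_def sets_measure_of[OF gen_subset_Pow(2)[of "Suc j"]] .
  qed
  have "(\<integral>\<omega>\<in>B. innovation g k \<omega> \<partial>M) = 0" if "B \<in> sets (\<G> (Suc j))" for B
  proof -
    have "Int_stable gen"
    proof (rule Int_stableI)
      fix a b assume "a \<in> gen" "b \<in> gen"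
      then obtain A S A' S' where "a = A \<inter> (Y (Suc j) -` S \<inter> space M)" "b = A' \<inter> (Y (Suc j) -` S' \<inter> space M)"
        "A \<in> sets (\<G> j)" "A' \<in> sets (\<G> j)" "S \<in> sets borel" "S' \<in> sets borel"
        by (auto simp: gen_def)
      then have "a \<inter> b = (A \<inter> A') \<inter> (Y (Suc j) -` (S \<inter> S') \<inter> space M)" "A \<inter> A' \<in> sets (\<G> j)" "S \<inter> S' \<in> sets borel"
        by auto
      then show "a \<inter> b \<in> gen"
        unfolding gen_def by (intro CollectI exI[of _ "A \<inter> A'"] exI[of _ "S \<inter> S'"]) auto
    qed
    moreover have "gen \<subseteq> Pow (space M)"
      using gen_sets sets.space_closed[of M] by blast
    moreover have "B \<in> sigma_sets (space M) gen"
      using that generates by blast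
    ultimately show ?thesis
    proof (induction rule: sigma_sets_induct_disjoint)
      case (basic a)
      then obtain A S where a: "a = A \<inter> (Y (Suc j) -` S \<inter> space M)" and AS: "A \<in> sets (\<G> j)" "S \<in> sets borel"
        by (auto simp: gen_def)
      have "(\<integral>\<omega>\<in>a. innovation g k \<omega> \<partial>M) = (\<integral>\<omega>. innovation g k \<omega> * indicator A \<omega> * indicator S (Y (Suc j) \<omega>) \<partial>M)"
        unfolding set_lebesgue_integral_def a
        by (intro Bochner_Integration.integral_cong) (auto split: split_indicator)
      with rectangle[OF AS] show ?case by simp
    next
      case empty
      then show ?case by (simp add: set_lebesgue_integral_def)
    next
      case (compl A)
      have AM: "A \<in> sets M"
        using compl(1) sets.sigma_sets_subset[OF gen_sets] by blast
      \<comment> \<open>Complements need the innovation to have mean zero, which is orthogonality to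
        the constant 1.\<close>
      have "(\<integral>\<omega>. innovation g k \<omega> * 1 \<partial>M) = 0"
        by (rule innovation_orthogonal_past[OF g gb]) auto
      moreover have "(\<integral>\<omega>\<in>space M - A. innovation g k \<omega> \<partial>M)
          = (\<integral>\<omega>. innovation g k \<omega> - indicator A \<omega> *\<^sub>R innovation g k \<omega> \<partial>M)"
        unfolding set_lebesgue_integral_def
        by (intro Bochner_Integration.integral_cong) (auto split: split_indicator)
      moreover have "integrable M (\<lambda>\<omega>. indicator A \<omega> *\<^sub>R innovation g k \<omega>)"
        using AM d_int by (rule integrable_mult_indicator)
      ultimately show ?case
        using compl(2) d_int by (simp add: set_lebesgue_integral_def)
    next
      case (union A)
      have AM: "A i \<in> sets M" for i
        using union(2) sets.sigma_sets_subset[OF gen_sets] by blast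
      have "(\<integral>\<omega>\<in>(\<Union>i. A i). innovation g k \<omega> \<partial>M) = (\<Sum>i. \<integral>\<omega>\<in>A i. innovation g k \<omega> \<partial>M)"
      proof (rule lebesgue_integral_countable_add)
        show "set_integrable M (\<Union>i. A i) (innovation g k)"
          unfolding set_integrable_def using AM d_int by (intro integrable_mult_indicator) auto
        show "A i \<inter> A j = {}" if "i \<noteq> j" for i j
          using union(1) that by (auto simp: disjoint_family_on_def)
      qed (rule AM)
      then show ?case using union(3) by simp
    qed
  qed
  then have "(\<integral>\<omega>. innovation g k \<omega> * indicator B \<omega> \<partial>M) = 0" if "B \<in> sets (\<G> (Suc j))" for B
    using that by (simp add: set_lebesgue_integral_def mult.commute)
  from integral_mult_eq_0_of_sets[OF prob_space_axioms subalgebra_M(2) step.prems dM db this]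
  show ?case .
qed


subsection \<open>The resampling error\<close>

text \<open>
  When all weights vanish the resampling measure is undefined and the hypotheses leave the new
  state arbitrary; \<open>\<psi>\<close> is then evaluated at that state.
\<close>

definition resampled :: "('a \<Rightarrow> real) \<Rightarrow> ('a \<Rightarrow> real) \<Rightarrow> nat \<Rightarrow> 'w \<Rightarrow> real" where
  "resampled \<phi> \<psi> k \<omega> = \<delta> k \<omega> * \<theta> k \<phi> \<omega> + (1 - \<delta> k \<omega>) * \<psi> (X (Suc k) \<omega>)"

lemma resampled_measurable:
  assumes [measurable]: "\<phi> \<in> borel_measurable borel" "\<psi> \<in> borel_measurable borel"
  shows "resampled \<phi> \<psi> k \<in> borel_measurable M"
proof -
  have [measurable]: "\<delta> k \<in> borel_measurable M" "\<theta> k \<phi> \<in> borel_measurable M"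
    by (auto intro!: \<delta>_measurable theta_measurable)
  show ?thesis unfolding resampled_def[abs_def] by measurable
qed

lemma resampled_bound:
  assumes "\<And>x. \<bar>\<phi> x\<bar> \<le> C" "\<And>x. \<bar>\<psi> x\<bar> \<le> C"
  shows "\<bar>resampled \<phi> \<psi> k \<omega>\<bar> \<le> C"
  using \<delta>_cases[of k \<omega>] theta_bound[of \<phi> C k \<omega>, OF assms(1)] assms(2)
  by (auto simp: resampled_def)

text \<open>When the weights vanish both sides are zero, whatever value replaces the average; hence
  the arbitrary new state is admissible in \<open>emp_weighted_eq\<close>.\<close>

lemma resampled_mult_weights:
  assumes "0 < k"
  shows "resampled \<phi> \<psi> k \<omega> * (\<Sum>i=1..k. w (Y i \<omega>)) = (\<Sum>i=1..k. w (Y i \<omega>) * \<phi> (Y i \<omega>))"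
proof (cases "\<delta> k \<omega> = 1")
  case True
  then show ?thesis using theta_mult_weights[OF assms True, of \<phi>] by (simp add: resampled_def)
next
  case False
  then have "w (Y i \<omega>) = 0" if "i \<in> {1..k}" for i
    using weights_eq_0[OF _ that] \<delta>_cases[of k \<omega>] by auto
  then show ?thesis by simp
qed

text \<open>Two integrands with a common bound are allowed because the mean square error resamples a
  multiple of the Poisson solution but charges \<open>f\<close> itself when the weights
  vanish.\<close>

lemma resampling_error_square_le:
  assumes k: "0 < k" and [measurable]: "\<phi> \<in> borel_measurable borel" "\<psi> \<in> borel_measurable borel"
    and b: "\<And>x. \<bar>\<phi> x\<bar> \<le> C" "\<And>x. \<bar>\<psi> x\<bar> \<le> C"
  shows "(\<integral>\<omega>. (resampled \<phi> \<psi> k \<omega> - (\<integral>x. \<phi> x \<partial>\<pi>))\<^sup>2 \<partial>M) \<le> 2 * (supnorm w)\<^sup>2 * C\<^sup>2 * D2 k"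
  using k assms(2) resampled_measurable[OF assms(2,3)] b(1) resampled_bound[of \<phi> C \<psi>, OF b]
    resampled_mult_weights[OF k]
  by (rule self_normalized_square_le)

text \<open>The factor 2 is cancelled by the 1/2 in \<open>tv_dist\<close>.\<close>

lemma resampling_bias_le:
  assumes g: "g \<in> bdd1"
  shows "\<bar>\<integral>\<omega>. \<zeta> (Suc k) \<omega> * (resampled g g k \<omega> - (\<integral>x. g x \<partial>\<pi>)) \<partial>M\<bar> \<le> 2 * Bseq M \<pi>Y Y w (int k)"
proof -
  have [measurable]: "g \<in> borel_measurable borel" and gb: "\<bar>g x\<bar> \<le> 1" for x
    using g by (auto simp: bdd1_def)
  have [measurable]: "resampled g g k \<in> borel_measurable M" "\<zeta> i \<in> borel_measurable M" for i
    by (auto intro!: resampled_measurable \<zeta>_measurable)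
  define \<pi>g where "\<pi>g = (\<integral>x. g x \<partial>\<pi>)"
  define e where "e = (\<lambda>\<omega>. resampled g g k \<omega> - \<pi>g)"
  have \<pi>g: "\<bar>\<pi>g\<bar> \<le> 1"
    unfolding \<pi>g_def by (rule integral_target_bound) (auto simp: gb)
  have eb: "\<bar>e \<omega>\<bar> \<le> 2" for \<omega>
    using resampled_bound[of g 1 g k \<omega>, OF gb gb] \<pi>g unfolding e_def by linarith
  have em[measurable]: "e \<in> borel_measurable M" unfolding e_def by measurable
  have "\<bar>\<integral>\<omega>. \<zeta> (Suc k) \<omega> * e \<omega> \<partial>M\<bar> \<le> 2 * Bseq M \<pi>Y Y w (int k)"
  proof (cases "k = 0")
    case True
    \<comment> \<open>For \<open>k = 0\<close> the trivial bound 2 is all that is available, and it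
      is twice \<open>B_0 = 1\<close>.\<close>
    have "\<bar>\<zeta> (Suc k) \<omega> * e \<omega>\<bar> \<le> 2" for \<omega>
      using mult_mono[OF \<zeta>_bound(1)[of "Suc k" \<omega>] eb[of \<omega>]] by (simp add: abs_mult)
    then show ?thesis
      using True by (intro abs_integral_le_bound[OF prob_space_axioms]) (auto simp: Bseq_def)
  next
    case False
    then have k: "0 < k" by simp
    let ?b = "emp k w"
    define a where "a = emp k (\<lambda>x. w x * (g x - \<pi>g))"
    have cb: "\<bar>g x - \<pi>g\<bar> \<le> 2" for x using gb[of x] \<pi>g by linarith
    note wb = weighted_integrand_bound[of "\<lambda>x. g x - \<pi>g", OF cb]
    have a_eq: "e \<omega> = a \<omega> - e \<omega> * ?b \<omega>" for \<omega>
    proof -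
      have "a \<omega> = emp k (\<lambda>x. w x * g x + (- \<pi>g) * w x) \<omega>"
        unfolding a_def by (simp add: algebra_simps)
      also have "\<dots> = emp k (\<lambda>x. w x * g x) \<omega> + (- \<pi>g) * ?b \<omega>"
        unfolding emp_cmult[symmetric]
        using weighted_integrand_bound[of g 1, OF gb] weighted_integrand_bound[of "\<lambda>_. - \<pi>g" 1] \<pi>g
        by (intro emp_add[where C = "supnorm w * 1" and C' = "supnorm w * 1"]) (auto simp: mult.commute)
      finally show ?thesis
        using emp_weighted_eq[OF k _ resampled_mult_weights[OF k, of g g \<omega>]]
        by (simp add: e_def \<pi>g_def algebra_simps)
    qed
    have aF: "a \<in> borel_measurable (\<F> k)"
      unfolding a_def by (rule emp_measurable) (auto intro!: adapted_measurable)
    have a_int: "integrable M a"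
      unfolding a_def by (rule emp_integrable(1)[OF _ wb]) simp
    have b_bd: "\<bar>w x\<bar> \<le> supnorm w" for x using w_le[of x] w_nonneg[of x] by simp
    have b2_int: "integrable M (\<lambda>\<omega>. (?b \<omega>)\<^sup>2)"
      by (rule emp_integrable(2)[OF w_measurable b_bd])
    have b_int: "integrable M ?b"
      by (rule emp_integrable(1)[OF w_measurable b_bd])
    have e2_int: "integrable M (\<lambda>\<omega>. (e \<omega>)\<^sup>2)"
      using integrable_mult_bounded[OF integrable_bounded[OF em eb] em eb] by (simp add: power2_eq_square)
    have be_int: "integrable M (\<lambda>\<omega>. ?b \<omega> * e \<omega>)"
      by (rule integrable_mult_bounded[OF b_int _ eb]) simp
    have be\<zeta>_int: "integrable M (\<lambda>\<omega>. ?b \<omega> * e \<omega> * \<zeta> (Suc k) \<omega>)"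
      by (rule integrable_mult_bounded[OF be_int, where C = 1]) (auto simp: \<zeta>_bound)
    have a\<zeta>_int: "integrable M (\<lambda>\<omega>. a \<omega> * \<zeta> (Suc k) \<omega>)"
      by (rule integrable_mult_bounded[OF a_int, where C = 1]) (auto simp: \<zeta>_bound)
    \<comment> \<open>The error \<open>e\<close> may contain \<open>X (Suc k)\<close>, so the coin
      cannot be averaged out of it. The linear part \<open>a\<close> is known at time k and yields
      \<epsilon>; the quadratic part keeps the coin, which is simply bounded by 1.\<close>
    have "\<zeta> (Suc k) \<omega> * e \<omega> = a \<omega> * \<zeta> (Suc k) \<omega> - ?b \<omega> * e \<omega> * \<zeta> (Suc k) \<omega>" for \<omega>
      by (subst a_eq) (simp add: algebra_simps)
    then have "(\<integral>\<omega>. \<zeta> (Suc k) \<omega> * e \<omega> \<partial>M) = \<epsilon> * (\<integral>\<omega>. a \<omega> \<partial>M) - (\<integral>\<omega>. ?b \<omega> * e \<omega> * \<zeta> (Suc k) \<omega> \<partial>M)"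
      using a\<zeta>_int be\<zeta>_int integral_\<zeta>_mult[OF aF a_int] by simp
    moreover have "\<bar>\<epsilon> * (\<integral>\<omega>. a \<omega> \<partial>M)\<bar> \<le> 2 * supnorm w * D1 k"
    proof -
      have "\<bar>\<integral>\<omega>. a \<omega> \<partial>M\<bar> \<le> supnorm w * 2 * D1 k"
        unfolding a_def by (rule emp_mean_le[OF _ wb]) simp
      moreover have "\<bar>\<epsilon> * (\<integral>\<omega>. a \<omega> \<partial>M)\<bar> \<le> 1 * \<bar>\<integral>\<omega>. a \<omega> \<partial>M\<bar>"
        unfolding abs_mult using eps by (intro mult_right_mono) auto
      ultimately show ?thesis by simp
    qed
    moreover have "\<bar>\<integral>\<omega>. ?b \<omega> * e \<omega> * \<zeta> (Suc k) \<omega> \<partial>M\<bar> \<le> 4 * (supnorm w)\<^sup>2 * D2 k"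
    proof -
      have pt: "\<bar>?b \<omega> * e \<omega> * \<zeta> (Suc k) \<omega>\<bar> \<le> (?b \<omega>)\<^sup>2 + (e \<omega>)\<^sup>2" for \<omega>
      proof -
        have "\<bar>?b \<omega> * e \<omega> * \<zeta> (Suc k) \<omega>\<bar> \<le> \<bar>?b \<omega>\<bar> * \<bar>e \<omega>\<bar>"
          using mult_left_mono[OF \<zeta>_bound(1)[of "Suc k" \<omega>], of "\<bar>?b \<omega>\<bar> * \<bar>e \<omega>\<bar>"] by (simp add: abs_mult)
        also have "2 * (\<bar>?b \<omega>\<bar> * \<bar>e \<omega>\<bar>) \<le> (?b \<omega>)\<^sup>2 + (e \<omega>)\<^sup>2"
          using sum_squares_bound[of "\<bar>?b \<omega>\<bar>" "\<bar>e \<omega>\<bar>"] by simp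
        finally show ?thesis by (smt (verit) abs_ge_zero)
      qed
      have "\<bar>\<integral>\<omega>. ?b \<omega> * e \<omega> * \<zeta> (Suc k) \<omega> \<partial>M\<bar> \<le> (\<integral>\<omega>. \<bar>?b \<omega> * e \<omega> * \<zeta> (Suc k) \<omega>\<bar> \<partial>M)"
        by (rule integral_abs_bound)
      also have "\<dots> \<le> (\<integral>\<omega>. (?b \<omega>)\<^sup>2 + (e \<omega>)\<^sup>2 \<partial>M)"
        using be\<zeta>_int b2_int e2_int pt by (intro integral_mono) auto
      also have "\<dots> = (\<integral>\<omega>. (?b \<omega>)\<^sup>2 \<partial>M) + (\<integral>\<omega>. (e \<omega>)\<^sup>2 \<partial>M)"
        using b2_int e2_int by simp
      \<comment> \<open>The weight contributes 1/4 by midpoint centring and the error contributes 2;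
        their sum stays below the available 4.\<close>
      also have "\<dots> \<le> (supnorm w)\<^sup>2 * D2 k / 4 + 2 * (supnorm w)\<^sup>2 * D2 k"
        using emp_weight_square_le[OF k] resampling_error_square_le[OF k, of g g 1] gb
        by (intro add_mono) (simp_all add: e_def \<pi>g_def)
      also have "\<dots> \<le> 4 * (supnorm w)\<^sup>2 * D2 k"
        using D_nonneg(2)[OF k] by (simp add: mult_nonneg_nonneg)
      finally show ?thesis .
    qed
    ultimately show ?thesis
      unfolding Bseq_eq[OF k] by (simp add: algebra_simps)
  qed
  then show ?thesis by (simp add: e_def \<pi>g_def)
qed

subsection \<open>Total variation\<close>

lemma invariance:
  assumes "g \<in> borel_measurable borel" "\<And>x. \<bar>g x\<bar> \<le> C"
  shows "(\<integral>x. Pf g x \<partial>\<pi>) = (\<integral>x. g x \<partial>\<pi>)"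
  unfolding Pf_def by (rule invariant_integral[OF P_kernel p(4) sets_targets(1) P_stat assms])

text \<open>By invariance the integral of \<open>g\<close> against \<pi> splits in the same
  proportions as the step of the chain. The kernel part is controlled because \<open>Pf g\<close> is
  again in \<open>bdd1\<close>; the other part is exactly the resampling bias.\<close>

lemma tv_dist_step:
  "tv_dist (distr M borel (X (Suc k))) \<pi>
    \<le> (1 - \<epsilon>) * tv_dist (distr M borel (X k)) \<pi> + Bseq M \<pi>Y Y w (int k)"
proof (rule tv_dist_leI)
  fix g :: "'a \<Rightarrow> real" assume g: "g \<in> bdd1"
  then have gm[measurable]: "g \<in> borel_measurable borel" and gb: "\<bar>g x\<bar> \<le> 1" for x
    by (auto simp: bdd1_def)
  have Pg: "Pf g \<in> bdd1"
    using Pf_measurable[OF gm] Pf_bound[OF gm gb] by (simp add: bdd1_def)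
  have [measurable]: "\<zeta> (Suc k) \<in> borel_measurable M" "resampled g g k \<in> borel_measurable M"
    "\<delta> k \<in> borel_measurable M" "\<theta> k g \<in> borel_measurable M"
    by (auto intro!: \<zeta>_measurable resampled_measurable \<delta>_measurable theta_measurable)
  have \<zeta>_int: "integrable M (\<zeta> (Suc k))"
    by (rule integrable_bounded[OF _ \<zeta>_bound(1)]) simp
  have \<zeta>\<delta>: "integrable M (\<lambda>\<omega>. \<zeta> (Suc k) \<omega> * \<delta> k \<omega>)"
    by (rule integrable_mult_bounded[OF \<zeta>_int, where C = 1]) (auto simp: \<delta>_bound)
  have \<zeta>\<delta>': "integrable M (\<lambda>\<omega>. \<zeta> (Suc k) \<omega> * (1 - \<delta> k \<omega>))"
    by (rule integrable_mult_bounded[OF \<zeta>_int, where C = 1]) (auto simp: \<delta>_bound)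
  have \<zeta>g: "integrable M (\<lambda>\<omega>. \<zeta> (Suc k) \<omega> * g (X (Suc k) \<omega>))"
    and \<zeta>r: "integrable M (\<lambda>\<omega>. \<zeta> (Suc k) \<omega> * resampled g g k \<omega>)"
    by (rule integrable_mult_bounded[OF \<zeta>_int, where C = 1]; use gb resampled_bound[of g 1 g, OF gb gb] in simp)+
  have i1: "integrable M (\<lambda>\<omega>. \<zeta> (Suc k) \<omega> * \<delta> k \<omega> * g (X (Suc k) \<omega>))"
    and i2: "integrable M (\<lambda>\<omega>. \<zeta> (Suc k) \<omega> * \<delta> k \<omega> * \<theta> k g \<omega>)"
    by (rule integrable_mult_bounded[OF \<zeta>\<delta>, where C = 1]; use gb theta_bound[of g 1, OF gb] in simp)+
  have i3: "integrable M (\<lambda>\<omega>. \<zeta> (Suc k) \<omega> * (1 - \<delta> k \<omega>) * g (X (Suc k) \<omega>))"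
    by (rule integrable_mult_bounded[OF \<zeta>\<delta>', where C = 1]) (use gb in auto)
  have g_int: "integrable M (\<lambda>\<omega>. g (X (Suc k) \<omega>))"
    by (rule integrable_bounded[OF _ gb]) simp
  \<comment> \<open>Only the part with \<open>\<delta> k\<close> equal to 1 is replaced by an
    average. Elsewhere the new state stays, as in \<open>resampled g g k\<close>, so the identity is
    exact.\<close>
  have "(\<integral>\<omega>. \<zeta> (Suc k) \<omega> * g (X (Suc k) \<omega>) \<partial>M)
      = (\<integral>\<omega>. \<zeta> (Suc k) \<omega> * \<delta> k \<omega> * g (X (Suc k) \<omega>) + \<zeta> (Suc k) \<omega> * (1 - \<delta> k \<omega>) * g (X (Suc k) \<omega>) \<partial>M)"
    by (intro Bochner_Integration.integral_cong) (auto simp: algebra_simps)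
  also have "\<dots> = (\<integral>\<omega>. \<zeta> (Suc k) \<omega> * \<delta> k \<omega> * \<theta> k g \<omega> + \<zeta> (Suc k) \<omega> * (1 - \<delta> k \<omega>) * g (X (Suc k) \<omega>) \<partial>M)"
    using step_integrals(1)[OF borel_measurable_const integrable_const gm gb, of 1 k] i1 i2 i3
    by simp
  also have "\<dots> = (\<integral>\<omega>. \<zeta> (Suc k) \<omega> * resampled g g k \<omega> \<partial>M)"
    by (intro Bochner_Integration.integral_cong) (auto simp: resampled_def algebra_simps)
  finally have resample: "(\<integral>\<omega>. \<zeta> (Suc k) \<omega> * g (X (Suc k) \<omega>) \<partial>M) = (\<integral>\<omega>. \<zeta> (Suc k) \<omega> * resampled g g k \<omega> \<partial>M)" .
  have "(\<integral>\<omega>. \<zeta> (Suc k) \<omega> \<partial>M) = \<epsilon>"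
    using integral_\<zeta>_mult[OF borel_measurable_const integrable_const, of 1 k] by (simp add: prob_space)
  then have bias: "(\<integral>\<omega>. \<zeta> (Suc k) \<omega> * (resampled g g k \<omega> - (\<integral>x. g x \<partial>\<pi>)) \<partial>M)
      = (\<integral>\<omega>. \<zeta> (Suc k) \<omega> * resampled g g k \<omega> \<partial>M) - \<epsilon> * (\<integral>x. g x \<partial>\<pi>)"
    using \<zeta>_int \<zeta>r by (simp add: right_diff_distrib)
  have "(\<integral>\<omega>. g (X (Suc k) \<omega>) \<partial>M)
      = (\<integral>\<omega>. g (X (Suc k) \<omega>) - \<zeta> (Suc k) \<omega> * g (X (Suc k) \<omega>) \<partial>M) + (\<integral>\<omega>. \<zeta> (Suc k) \<omega> * g (X (Suc k) \<omega>) \<partial>M)"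
    using g_int \<zeta>g by simp
  also have "(\<integral>\<omega>. g (X (Suc k) \<omega>) - \<zeta> (Suc k) \<omega> * g (X (Suc k) \<omega>) \<partial>M) = (1 - \<epsilon>) * (\<integral>\<omega>. Pf g (X k \<omega>) \<partial>M)"
    using kernel_step_integral[OF gm gb, of k] by (simp add: left_diff_distrib)
  finally have "(\<integral>\<omega>. g (X (Suc k) \<omega>) \<partial>M) - (\<integral>x. g x \<partial>\<pi>)
      = (1 - \<epsilon>) * ((\<integral>\<omega>. Pf g (X k \<omega>) \<partial>M) - (\<integral>x. Pf g x \<partial>\<pi>))
        + (\<integral>\<omega>. \<zeta> (Suc k) \<omega> * (resampled g g k \<omega> - (\<integral>x. g x \<partial>\<pi>)) \<partial>M)"
    unfolding resample bias invariance[OF gm gb] by (simp add: algebra_simps)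
  moreover have "\<bar>(1 - \<epsilon>) * ((\<integral>\<omega>. Pf g (X k \<omega>) \<partial>M) - (\<integral>x. Pf g x \<partial>\<pi>))\<bar>
      \<le> (1 - \<epsilon>) * (2 * tv_dist (distr M borel (X k)) \<pi>)"
  proof -
    have "\<bar>(\<integral>x. Pf g x \<partial>distr M borel (X k)) - (\<integral>x. Pf g x \<partial>\<pi>)\<bar> \<le> 2 * tv_dist (distr M borel (X k)) \<pi>"
      by (rule integral_diff_le_tv_dist[OF prob_space_distr _ p(4) sets_targets(1) Pg]) auto
    then show ?thesis
      using eps by (simp add: integral_distr[OF process_measurable(1) Pf_measurable[OF gm]] abs_mult mult_left_mono)
  qed
  ultimately show "\<bar>(\<integral>x. g x \<partial>distr M borel (X (Suc k))) - (\<integral>x. g x \<partial>\<pi>)\<bar>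
      \<le> 2 * ((1 - \<epsilon>) * tv_dist (distr M borel (X k)) \<pi> + Bseq M \<pi>Y Y w (int k))"
    using resampling_bias_le[OF g, of k]
    unfolding integral_distr[OF process_measurable(1) gm] distrib_left abs_le_iff by linarith
qed

lemma tv_dist_bound:
  "tv_dist (distr M borel (X n)) \<pi> \<le> (\<Sum>l=0..n. (1 - \<epsilon>) ^ (n - l) * Bseq M \<pi>Y Y w (int l - 1))"
proof (induction n)
  case 0
  \<comment> \<open>Total variation never exceeds 1, which is \<open>B_{-1}\<close>. In the
    induction step the new summand, with l = n + 1, is \<open>B_n\<close>.\<close>
  have "\<bar>(\<integral>x. g x \<partial>distr M borel (X 0)) - (\<integral>x. g x \<partial>\<pi>)\<bar> \<le> 2 * 1" if "g \<in> bdd1" for g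
  proof -
    have [measurable]: "g \<in> borel_measurable borel" and gb: "\<bar>g x\<bar> \<le> 1" for x
      using that by (auto simp: bdd1_def)
    have "\<bar>\<integral>\<omega>. g (X 0 \<omega>) \<partial>M\<bar> \<le> 1"
      by (rule abs_integral_le_bound[OF prob_space_axioms]) (auto simp: gb)
    moreover have "\<bar>\<integral>x. g x \<partial>\<pi>\<bar> \<le> 1"
      by (rule integral_target_bound) (auto simp: gb)
    ultimately show ?thesis
      by (simp add: integral_distr[OF process_measurable(1)])
  qed
  from tv_dist_leI[OF this] show ?case by (simp add: Bseq_def)
next
  case (Suc n)
  have "(1 - \<epsilon>) * tv_dist (distr M borel (X n)) \<pi>
      \<le> (1 - \<epsilon>) * (\<Sum>l=0..n. (1 - \<epsilon>) ^ (n - l) * Bseq M \<pi>Y Y w (int l - 1))"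
    using Suc eps by (intro mult_left_mono) auto
  also have "\<dots> = (\<Sum>l=0..n. (1 - \<epsilon>) ^ (Suc n - l) * Bseq M \<pi>Y Y w (int l - 1))"
    by (simp add: sum_distrib_left Suc_diff_le mult.assoc)
  finally show ?case
    using tv_dist_step[of n] by simp
qed

subsection \<open>Mean square error\<close>

text \<open>The part of the error with defined weights is a functional of \<open>Y\<close>,
  orthogonal to every innovation. The other part contains \<open>X (Suc j)\<close>: if
  \<open>i \<le> j\<close> its product with the innovation is identically zero, since defined
  weights at time i stay defined; if \<open>j < i\<close> it belongs to the past of the
  innovation.\<close>

lemma innovation_orthogonal_error:
  assumes g: "g \<in> borel_measurable borel" and gb: "\<And>x. \<bar>g x\<bar> \<le> C"
    and \<phi>: "\<phi> \<in> borel_measurable borel" "\<And>x. \<bar>\<phi> x\<bar> \<le> C'"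
    and \<psi>: "\<psi> \<in> borel_measurable borel" "\<And>x. \<bar>\<psi> x\<bar> \<le> C'"
    and i: "0 < i" and j: "0 < j"
  shows "(\<integral>\<omega>. innovation g i \<omega> * (resampled \<phi> \<psi> j \<omega> - c) \<partial>M) = 0"
proof -
  define V1 where "V1 = (\<lambda>\<omega>. \<delta> j \<omega> * (\<theta> j \<phi> \<omega> - c))"
  define V2 where "V2 = (\<lambda>\<omega>. (1 - \<delta> j \<omega>) * (\<psi> (X (Suc j) \<omega>) - c))"
  let ?m = "max i j"
  have G: "V1 \<in> borel_measurable (\<G> ?m)"
    unfolding V1_def
    by (intro borel_measurable_times borel_measurable_diff borel_measurable_const \<delta>_measurable
        theta_measurable \<phi> adapted_measurable(3)) auto
  have F: "V2 \<in> borel_measurable (\<F> (Suc j))"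
    unfolding V2_def
    by (intro borel_measurable_times borel_measurable_diff borel_measurable_const \<delta>_measurable
        adapted_measurable(2) measurable_compose[OF adapted_measurable(1) \<psi>(1)]) auto
  have V1M: "V1 \<in> borel_measurable M" and V2M: "V2 \<in> borel_measurable M"
    by (rule measurable_from_subalg[OF subalgebra_M(2) G] measurable_from_subalg[OF subalgebra_M(1) F])+
  have C': "0 \<le> C'" using \<phi>(2)[of undefined] by simp
  have "\<bar>V1 \<omega>\<bar> \<le> C' + \<bar>c\<bar>" "\<bar>V2 \<omega>\<bar> \<le> C' + \<bar>c\<bar>" for \<omega>
    using \<delta>_cases[of j \<omega>] theta_bound[of \<phi> C' j \<omega>, OF \<phi>(2)] \<psi>(2)[of "X (Suc j) \<omega>"] C'
    by (auto simp: V1_def V2_def)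
  then have V_int: "integrable M V1" "integrable M V2"
    using integrable_bounded[OF V1M] integrable_bounded[OF V2M] by blast+
  note dm = innovation_measurable(2)[OF g, of i] and db = innovation_bound[OF g gb, of i]
  have "(\<integral>\<omega>. innovation g i \<omega> * V1 \<omega> \<partial>M) = 0"
    by (rule innovation_orthogonal_auxiliary[OF g gb _ G V_int(1)]) simp
  moreover have "(\<integral>\<omega>. innovation g i \<omega> * V2 \<omega> \<partial>M) = 0"
  proof (cases "i \<le> j")
    case True
    then have eq: "innovation g i \<omega> * V2 \<omega> = 0" for \<omega>
      using \<delta>_mono[OF i True, of \<omega>] \<delta>_cases[of i \<omega>] by (auto simp: innovation_def V2_def)
    show ?thesis unfolding eq by simp
  next
    case False
    then have "Suc j \<le> i" by simp
    from measurable_from_subalg[OF subalgebra_F[OF this] F] show ?thesis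
      using V_int(2) by (rule innovation_orthogonal_past[OF g gb])
  qed
  moreover have "innovation g i \<omega> * (resampled \<phi> \<psi> j \<omega> - c) = innovation g i \<omega> * V1 \<omega> + innovation g i \<omega> * V2 \<omega>" for \<omega>
    by (simp add: resampled_def V1_def V2_def algebra_simps)
  moreover have "integrable M (\<lambda>\<omega>. innovation g i \<omega> * V1 \<omega>)" "integrable M (\<lambda>\<omega>. innovation g i \<omega> * V2 \<omega>)"
    using integrable_mult_bounded[OF V_int(1) dm db] integrable_mult_bounded[OF V_int(2) dm db]
    by (simp_all add: mult.commute)
  ultimately show ?thesis by simp
qed

lemma innovations_orthogonal:
  assumes g: "g \<in> borel_measurable borel" and gb: "\<And>x. \<bar>g x\<bar> \<le> C" and "i \<noteq> j"
  shows "(\<integral>\<omega>. innovation g i \<omega> * innovation g j \<omega> \<partial>M) = 0"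
proof -
  have "(\<integral>\<omega>. innovation g i \<omega> * innovation g j \<omega> \<partial>M) = 0" if "j < i" for i j
  proof (rule innovation_orthogonal_past[OF g gb])
    show "innovation g j \<in> borel_measurable (\<F> i)"
      using that by (intro measurable_from_subalg[OF subalgebra_F innovation_measurable(1)[OF g]]) simp
    show "integrable M (innovation g j)"
      by (rule integrable_bounded[OF innovation_measurable(2)[OF g] innovation_bound[OF g gb]])
  qed
  from this[of j i] this[of i j] \<open>i \<noteq> j\<close> show ?thesis
    by (cases "i < j") (auto simp: mult.commute)
qed

lemma mean_square_bound:
  assumes f[measurable]: "f \<in> borel_measurable borel" and fb: "\<And>x. \<bar>f x\<bar> \<le> F" and n: "1 \<le> n"
  shows "(\<integral>\<omega>. (\<Sum>i=1..n. f (X i \<omega>) - (\<integral>x. f x \<partial>\<pi>))\<^sup>2 \<partial>M)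
    \<le> F\<^sup>2 * (64 / \<epsilon>\<^sup>2 * n + 80 / \<epsilon>\<^sup>2 + (\<Sum>k=0..n-1. sqrt (Bseq M \<pi>Y Y w (int k)))\<^sup>2)"
proof -
  have F0: "0 \<le> F" using fb[of undefined] by simp
  obtain g where g[measurable]: "g \<in> borel_measurable borel" and gb: "\<And>x. \<bar>g x\<bar> \<le> F / \<epsilon>"
    and poisson: "\<And>x. g x = f x + (1 - \<epsilon>) * Pf g x"
    using poisson_equation[OF P_kernel f fb eps] unfolding Pf_def by metis
  define \<pi>f where "\<pi>f = (\<integral>x. f x \<partial>\<pi>)"
  \<comment> \<open>The decomposition produces \<epsilon> times the resampled average of
    \<open>g\<close>. Absorbing \<epsilon> gives a function bounded by \<open>F\<close> whose mean
    under \<pi> is that of \<open>f\<close>.\<close>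
  define h where "h = (\<lambda>x. \<epsilon> * g x)"
  have hm[measurable]: "h \<in> borel_measurable borel" by (simp add: h_def)
  have hb: "\<bar>h x\<bar> \<le> F" for x
    using gb[of x] eps by (simp add: h_def abs_mult field_simps)
  have \<pi>f: "\<bar>\<pi>f\<bar> \<le> F" unfolding \<pi>f_def by (rule integral_target_bound[OF f fb])
  have \<pi>h: "(\<integral>x. h x \<partial>\<pi>) = \<pi>f"
  proof -
    have "(\<integral>x. g x \<partial>\<pi>) = (\<integral>x. f x + (1 - \<epsilon>) * Pf g x \<partial>\<pi>)"
      using poisson by simp
    also have "\<dots> = \<pi>f + (1 - \<epsilon>) * (\<integral>x. g x \<partial>\<pi>)"
      using integrable_targets(1)[OF f fb] integrable_targets(1)[OF Pf_measurable[OF g] Pf_bound[OF g gb]]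
        invariance[OF g gb] by (simp add: \<pi>f_def)
    finally show ?thesis by (simp add: h_def algebra_simps)
  qed
  define d where "d = innovation g"
  define e where "e = (\<lambda>k \<omega>. resampled h f k \<omega> - \<pi>f)"
  define c where "c = Pf g"
  \<comment> \<open>The boundary terms. As \<open>\<delta>\<close> is monotone only from time 1 on,
    the decomposition starts there and the contribution of \<open>X 1\<close> is kept here.\<close>
  define A where "A = (\<lambda>\<omega>. f (X 1 \<omega>) - \<pi>f
    + (1 - \<epsilon>) * (\<Sum>k=1..<n. if 0 < k \<and> \<delta> k \<omega> = 1 then c (X k \<omega>) - c (X (Suc k) \<omega>) else 0))"
  define D where "D = (\<lambda>\<omega>. \<Sum>k=1..<n. d k \<omega>)"
  define Q where "Q = (\<lambda>\<omega>. \<Sum>k=1..<n. e k \<omega>)"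
  \<comment> \<open>With defined weights this is the Poisson equation at \<open>X (Suc k)\<close>.
    Otherwise \<open>e k\<close> alone is the increment, because the second argument of
    \<open>resampled\<close> is \<open>f\<close>.\<close>
  have increment: "f (X (Suc k) \<omega>) - \<pi>f
      = d k \<omega> + (1 - \<epsilon>) * (if \<delta> k \<omega> = 1 then c (X k \<omega>) - c (X (Suc k) \<omega>) else 0) + e k \<omega>" for k \<omega>
  proof (cases "\<delta> k \<omega> = 1")
    case True
    have "\<theta> k h \<omega> = \<epsilon> * \<theta> k g \<omega>"
      by (simp add: theta_int_def h_def sum_distrib_left mult_ac)
    then show ?thesis
      using True poisson[of "X (Suc k) \<omega>"]
      by (simp add: d_def e_def c_def innovation_def resampled_def algebra_simps)
  next
    case False
    then have "\<delta> k \<omega> = 0" using \<delta>_cases by blast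
    then show ?thesis by (simp add: d_def e_def innovation_def resampled_def)
  qed
  have decomposition: "(\<Sum>i=1..n. f (X i \<omega>) - \<pi>f) = D \<omega> + A \<omega> + Q \<omega>" for \<omega>
  proof -
    have "(\<Sum>i=1..n. f (X i \<omega>) - \<pi>f) = (f (X 1 \<omega>) - \<pi>f) + (\<Sum>i=Suc 1..n. f (X i \<omega>) - \<pi>f)"
      using n by (rule sum.atLeast_Suc_atMost)
    also have "(\<Sum>i=Suc 1..n. f (X i \<omega>) - \<pi>f) = (\<Sum>k=1..<n. f (X (Suc k) \<omega>) - \<pi>f)"
      unfolding atLeastLessThanSuc_atLeastAtMost[symmetric] by (rule sum.shift_bounds_Suc_ivl)
    also have "\<dots> = D \<omega> + (1 - \<epsilon>) * (\<Sum>k=1..<n. if 0 < k \<and> \<delta> k \<omega> = 1 then c (X k \<omega>) - c (X (Suc k) \<omega>) else 0) + Q \<omega>"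
      unfolding D_def Q_def sum_distrib_left sum.distrib[symmetric]
      by (intro sum.cong refl) (simp add: increment)
    finally show ?thesis by (simp add: A_def)
  qed
  have inv_eps: "1 \<le> 1 / \<epsilon>" using eps by simp
  have Ab: "\<bar>A \<omega>\<bar> \<le> 2 * F / \<epsilon>" for \<omega>
  proof -
    obtain m where m: "n = Suc m" using n by (cases n) auto
    have "\<exists>j. (\<Sum>k=1..<Suc m. if 0 < k \<and> \<delta> k \<omega> = 1 then c (X k \<omega>) - c (X (Suc k) \<omega>) else 0)
        = c (X j \<omega>) - c (X (Suc m) \<omega>)"
      by (rule telescoping_tail[of "\<lambda>k. 0 < k \<and> \<delta> k \<omega> = 1" "\<lambda>k. c (X k \<omega>)"])
        (use \<delta>_mono[of _ _ \<omega>] in auto)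
    then obtain j where j: "(\<Sum>k=1..<n. if 0 < k \<and> \<delta> k \<omega> = 1 then c (X k \<omega>) - c (X (Suc k) \<omega>) else 0)
        = c (X j \<omega>) - c (X n \<omega>)"
      using m by auto
    have "\<bar>c (X j \<omega>) - c (X n \<omega>)\<bar> \<le> 2 * F / \<epsilon>"
      using Pf_bound[OF g gb, of "X j \<omega>"] Pf_bound[OF g gb, of "X n \<omega>"] unfolding c_def by simp
    \<comment> \<open>The telescoped part is at most \<open>2 * F / \<epsilon> - 2 * F\<close>, and
      the first summand of \<open>A\<close> at most \<open>2 * F\<close>.\<close>
    then have "\<bar>(1 - \<epsilon>) * (c (X j \<omega>) - c (X n \<omega>))\<bar> \<le> (1 - \<epsilon>) * (2 * F / \<epsilon>)"
      using eps unfolding abs_mult by (intro mult_mono) auto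
    also have "\<dots> = 2 * F / \<epsilon> - 2 * F" using eps by (simp add: field_simps)
    finally show ?thesis
      using fb[of "X 1 \<omega>"] \<pi>f unfolding A_def j by linarith
  qed
  have eb: "\<bar>e k \<omega>\<bar> \<le> 2 * F" for k \<omega>
    using resampled_bound[of h F f k \<omega>, OF hb fb] \<pi>f unfolding e_def by linarith
  have Qb: "\<bar>Q \<omega>\<bar> \<le> 2 * F * n" for \<omega>
  proof -
    have "\<bar>Q \<omega>\<bar> \<le> (\<Sum>k=1..<n. 2 * F)"
      unfolding Q_def by (rule order_trans[OF sum_abs sum_mono]) (rule eb)
    also have "\<dots> \<le> 2 * F * n" using F0 by (simp add: mult_left_mono mult.commute)
    finally show ?thesis .
  qed
  have db: "\<bar>d k \<omega>\<bar> \<le> 2 * (F / \<epsilon>)" for k \<omega>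
    unfolding d_def by (rule innovation_bound[OF g gb])
  have dm[measurable]: "d k \<in> borel_measurable M" for k
    unfolding d_def by (rule innovation_measurable(2)[OF g])
  have em[measurable]: "e k \<in> borel_measurable M" for k
    unfolding e_def using resampled_measurable[OF hm f] by simp
  have d_int: "integrable M (d k)" and e_int: "integrable M (e k)" for k
    by (rule integrable_bounded[OF dm db] integrable_bounded[OF em eb])+
  have dd_int: "integrable M (\<lambda>\<omega>. d i \<omega> * d j \<omega>)" and de_int: "integrable M (\<lambda>\<omega>. d i \<omega> * e j \<omega>)"
    and ee_int: "integrable M (\<lambda>\<omega>. e i \<omega> * e j \<omega>)" for i j
    by (rule integrable_mult_bounded[OF d_int dm db] integrable_mult_bounded[OF d_int em eb]
        integrable_mult_bounded[OF e_int em eb])+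
  have DD: "(\<integral>\<omega>. (D \<omega>)\<^sup>2 \<partial>M) \<le> n * (2 * (F / \<epsilon>))\<^sup>2"
  proof -
    have "(\<integral>\<omega>. (D \<omega>)\<^sup>2 \<partial>M) = (\<Sum>i=1..<n. \<Sum>j=1..<n. \<integral>\<omega>. d i \<omega> * d j \<omega> \<partial>M)"
      unfolding D_def power2_eq_square sum_product using dd_int by simp
    also have "\<dots> = (\<Sum>i=1..<n. \<Sum>j=1..<n. if i = j then \<integral>\<omega>. (d i \<omega>)\<^sup>2 \<partial>M else 0)"
      by (intro sum.cong refl) (auto simp: d_def innovations_orthogonal[OF g gb] power2_eq_square)
    also have "\<dots> = (\<Sum>i=1..<n. \<integral>\<omega>. (d i \<omega>)\<^sup>2 \<partial>M)"
      by simp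
    also have "\<dots> \<le> (\<Sum>i=1..<n. (2 * (F / \<epsilon>))\<^sup>2)"
    proof (rule sum_mono)
      fix i
      have "(d i \<omega>)\<^sup>2 \<le> (2 * (F / \<epsilon>))\<^sup>2" for \<omega>
        using power_mono[OF db[of i \<omega>] abs_ge_zero, of 2] by simp
      then have "\<bar>\<integral>\<omega>. (d i \<omega>)\<^sup>2 \<partial>M\<bar> \<le> (2 * (F / \<epsilon>))\<^sup>2"
        by (intro abs_integral_le_bound[OF prob_space_axioms]) auto
      then show "(\<integral>\<omega>. (d i \<omega>)\<^sup>2 \<partial>M) \<le> (2 * (F / \<epsilon>))\<^sup>2" by simp
    qed
    also have "\<dots> \<le> n * (2 * (F / \<epsilon>))\<^sup>2"
      by (simp add: mult_right_mono)
    finally show ?thesis .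
  qed
  have DQ: "(\<integral>\<omega>. D \<omega> * Q \<omega> \<partial>M) = 0"
  proof -
    have "(\<integral>\<omega>. D \<omega> * Q \<omega> \<partial>M) = (\<Sum>i=1..<n. \<Sum>j=1..<n. \<integral>\<omega>. d i \<omega> * e j \<omega> \<partial>M)"
      unfolding D_def Q_def sum_product using de_int by simp
    also have "\<dots> = 0"
      by (intro sum.neutral ballI)
        (simp add: d_def e_def innovation_orthogonal_error[OF g gb hm hb f fb])
    finally show ?thesis .
  qed
  have QQ: "(\<integral>\<omega>. (Q \<omega>)\<^sup>2 \<partial>M) \<le> F\<^sup>2 * (\<Sum>k=0..n-1. sqrt (Bseq M \<pi>Y Y w (int k)))\<^sup>2"
  proof -
    have "(\<integral>\<omega>. (Q \<omega>)\<^sup>2 \<partial>M) \<le> (\<Sum>k=1..<n. F * sqrt (Bseq M \<pi>Y Y w (int k)))\<^sup>2"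
      unfolding Q_def
    proof (rule integral_sum_square_le[OF ee_int])
      fix k assume "k \<in> {1..<n}"
      then have k: "0 < k" by simp
      have "(\<integral>\<omega>. (e k \<omega>)\<^sup>2 \<partial>M) \<le> 2 * (supnorm w)\<^sup>2 * F\<^sup>2 * D2 k"
        using resampling_error_square_le[OF k hm f hb fb] by (simp add: e_def \<pi>h)
      also have "\<dots> \<le> F\<^sup>2 * Bseq M \<pi>Y Y w (int k)"
        using mult_left_mono[OF D2_le_Bseq[OF k], of "F\<^sup>2"] by (simp add: mult_ac)
      finally show "(\<integral>\<omega>. (e k \<omega>)\<^sup>2 \<partial>M) \<le> (F * sqrt (Bseq M \<pi>Y Y w (int k)))\<^sup>2"
        by (simp add: power_mult_distrib Bseq_nonneg)
      show "0 \<le> F * sqrt (Bseq M \<pi>Y Y w (int k))"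
        using F0 by (simp add: Bseq_nonneg)
    qed
    also have "\<dots> = F\<^sup>2 * (\<Sum>k=1..<n. sqrt (Bseq M \<pi>Y Y w (int k)))\<^sup>2"
      by (simp add: sum_distrib_left[symmetric] power_mult_distrib)
    also have "\<dots> \<le> F\<^sup>2 * (\<Sum>k=0..n-1. sqrt (Bseq M \<pi>Y Y w (int k)))\<^sup>2"
      by (intro mult_left_mono power_mono sum_mono2 sum_nonneg) (auto simp: Bseq_nonneg)
    finally show ?thesis .
  qed
  have Dm[measurable]: "D \<in> borel_measurable M" and Qm[measurable]: "Q \<in> borel_measurable M"
    unfolding D_def Q_def by measurable
  have DD_int: "integrable M (\<lambda>\<omega>. (D \<omega>)\<^sup>2)" and DQ_int: "integrable M (\<lambda>\<omega>. D \<omega> * Q \<omega>)"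
    and QQ_int: "integrable M (\<lambda>\<omega>. (Q \<omega>)\<^sup>2)"
    unfolding D_def Q_def power2_eq_square sum_product using dd_int de_int ee_int by simp_all
  define \<alpha> where "\<alpha> = 2 * F / \<epsilon>"
  \<comment> \<open>Young's inequality is spent on \<open>D * A\<close> only; on a product with
    \<open>Q\<close> it would push the coefficient of \<open>Q\<^sup>2\<close> above one. Instead
    \<open>D * Q\<close> integrates to zero, and \<open>A * Q\<close> is of order n by the pointwise
    bounds.\<close>
  have pt: "(\<Sum>i=1..n. f (X i \<omega>) - \<pi>f)\<^sup>2
      \<le> 2 * (D \<omega>)\<^sup>2 + (2 * \<alpha>\<^sup>2 + 2 * \<alpha> * (2 * F * n)) + (Q \<omega>)\<^sup>2 + 2 * (D \<omega> * Q \<omega>)" for \<omega>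
  proof -
    have "(A \<omega>)\<^sup>2 \<le> \<alpha>\<^sup>2"
      using power_mono[OF Ab[of \<omega>] abs_ge_zero, of 2] by (simp add: \<alpha>_def)
    moreover have "A \<omega> * Q \<omega> \<le> \<alpha> * (2 * F * n)"
      using mult_mono[OF Ab[of \<omega>] Qb[of \<omega>]] F0 eps abs_ge_self[of "A \<omega> * Q \<omega>"] by (simp add: \<alpha>_def abs_mult)
    moreover have "2 * (D \<omega> * A \<omega>) \<le> (D \<omega>)\<^sup>2 + (A \<omega>)\<^sup>2"
      using sum_squares_bound[of "D \<omega>" "A \<omega>"] by simp
    moreover have "(D \<omega> + A \<omega> + Q \<omega>)\<^sup>2
        = (D \<omega>)\<^sup>2 + (A \<omega>)\<^sup>2 + (Q \<omega>)\<^sup>2 + 2 * (D \<omega> * A \<omega>) + 2 * (D \<omega> * Q \<omega>) + 2 * (A \<omega> * Q \<omega>)"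
      by (simp add: power2_eq_square algebra_simps)
    ultimately show ?thesis unfolding decomposition by linarith
  qed
  have "(\<integral>\<omega>. (\<Sum>i=1..n. f (X i \<omega>) - \<pi>f)\<^sup>2 \<partial>M)
      \<le> (\<integral>\<omega>. 2 * (D \<omega>)\<^sup>2 + (2 * \<alpha>\<^sup>2 + 2 * \<alpha> * (2 * F * n)) + (Q \<omega>)\<^sup>2 + 2 * (D \<omega> * Q \<omega>) \<partial>M)"
    using DD_int DQ_int QQ_int by (intro integral_mono_AE' AE_I2 pt order_trans[OF zero_le_power2 pt]) simp
  also have "\<dots> = 2 * (\<integral>\<omega>. (D \<omega>)\<^sup>2 \<partial>M) + (2 * \<alpha>\<^sup>2 + 2 * \<alpha> * (2 * F * n)) + (\<integral>\<omega>. (Q \<omega>)\<^sup>2 \<partial>M)"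
    using DD_int DQ_int QQ_int DQ by (simp add: prob_space)
  also have "\<dots> \<le> 2 * (n * (2 * (F / \<epsilon>))\<^sup>2) + (2 * \<alpha>\<^sup>2 + 2 * \<alpha> * (2 * F * n))
      + F\<^sup>2 * (\<Sum>k=0..n-1. sqrt (Bseq M \<pi>Y Y w (int k)))\<^sup>2"
    using DD QQ by simp
  also have "\<dots> \<le> F\<^sup>2 * (64 / \<epsilon>\<^sup>2 * n + 80 / \<epsilon>\<^sup>2) + F\<^sup>2 * (\<Sum>k=0..n-1. sqrt (Bseq M \<pi>Y Y w (int k)))\<^sup>2"
  proof -
    \<comment> \<open>The terms linear in n have coefficients \<open>8 / \<epsilon>\<^sup>2\<close>
      and \<open>8 / \<epsilon>\<close>, the constant one \<open>8 / \<epsilon>\<^sup>2\<close>; all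
      fit easily into 64 and 80.\<close>
    have "1 / \<epsilon> \<le> 1 / \<epsilon>\<^sup>2"
      using eps by (intro divide_left_mono) (auto simp: power2_eq_square mult_le_one)
    then have "F\<^sup>2 * n * (1 / \<epsilon>) \<le> F\<^sup>2 * n * (1 / \<epsilon>\<^sup>2)"
      by (intro mult_left_mono) auto
    moreover have "0 \<le> F\<^sup>2 * n * (1 / \<epsilon>\<^sup>2)" "0 \<le> F\<^sup>2 * (1 / \<epsilon>\<^sup>2)" by simp_all
    moreover have "2 * (n * (2 * (F / \<epsilon>))\<^sup>2) = 8 * (F\<^sup>2 * n * (1 / \<epsilon>\<^sup>2))"
      "2 * \<alpha>\<^sup>2 = 8 * (F\<^sup>2 * (1 / \<epsilon>\<^sup>2))" "2 * \<alpha> * (2 * F * n) = 8 * (F\<^sup>2 * n * (1 / \<epsilon>))"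
      "F\<^sup>2 * (64 / \<epsilon>\<^sup>2 * n + 80 / \<epsilon>\<^sup>2) = 64 * (F\<^sup>2 * n * (1 / \<epsilon>\<^sup>2)) + 80 * (F\<^sup>2 * (1 / \<epsilon>\<^sup>2))"
      by (simp_all add: \<alpha>_def power2_eq_square algebra_simps)
    ultimately show ?thesis by linarith
  qed
  finally show ?thesis
    by (simp add: \<pi>f_def distrib_left)
qed

lemma normalized_mean_square_bound:
  fixes f :: "'a \<Rightarrow> real"
  assumes f: "f \<in> borel_measurable borel" "bounded (range f)" and n: "1 \<le> n"
  shows "(\<integral>\<omega>. ((1 / sqrt (real n)) * (\<Sum>i=1..n. f (X i \<omega>) - (\<integral>x. f x \<partial>\<pi>)))\<^sup>2 \<partial>M)
    \<le> 80 / \<epsilon>\<^sup>2 * (supnorm f)\<^sup>2 / real n + 64 / \<epsilon>\<^sup>2 * (supnorm f)\<^sup>2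
      + (supnorm f)\<^sup>2 * ((1 / sqrt (real n)) * (\<Sum>k=0..n-1. sqrt (Bseq M \<pi>Y Y w (int k))))\<^sup>2"
proof -
  let ?s = "\<Sum>k=0..n-1. sqrt (Bseq M \<pi>Y Y w (int k))"
  have scale: "((1 / sqrt (real n)) * x)\<^sup>2 = (1 / n) * x\<^sup>2" for x
    by (simp add: power_mult_distrib power_divide)
  have "(\<integral>\<omega>. ((1 / sqrt (real n)) * (\<Sum>i=1..n. f (X i \<omega>) - (\<integral>x. f x \<partial>\<pi>)))\<^sup>2 \<partial>M)
      = (1 / n) * (\<integral>\<omega>. (\<Sum>i=1..n. f (X i \<omega>) - (\<integral>x. f x \<partial>\<pi>))\<^sup>2 \<partial>M)"
    unfolding scale by simp
  also have "\<dots> \<le> (1 / n) * ((supnorm f)\<^sup>2 * (64 / \<epsilon>\<^sup>2 * n + 80 / \<epsilon>\<^sup>2 + ?s\<^sup>2))"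
    by (intro mult_left_mono mean_square_bound f(1) n abs_le_supnorm[OF f(2)]) simp
  also have "\<dots> = 80 / \<epsilon>\<^sup>2 * (supnorm f)\<^sup>2 / real n + 64 / \<epsilon>\<^sup>2 * (supnorm f)\<^sup>2 + (supnorm f)\<^sup>2 * ((1 / n) * ?s\<^sup>2)"
    using n by (simp add: distrib_left add_divide_distrib mult_ac)
  finally show ?thesis unfolding scale .
qed

end

theorem theorem1:
  fixes M :: "'w measure"
    and dx \<pi> \<pi>Y :: "'a::polish_space measure"
    and p q w :: "'a \<Rightarrow> real"
    and P :: "'a \<Rightarrow> 'a measure"
    and \<epsilon> :: real
    and x0 y0 :: 'a
    and X Y :: "nat \<Rightarrow> 'w \<Rightarrow> 'a"
    and Z :: "nat \<Rightarrow> 'w \<Rightarrow> bool"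
  assumes dx: "sigma_finite_measure dx" "sets dx = sets borel"
    and p: "p \<in> borel_measurable borel" "\<forall>x. p x \<ge> 0" "\<pi> = density dx (\<lambda>x. ennreal (p x))"
           "prob_space \<pi>"
    and q: "q \<in> borel_measurable borel" "\<forall>x. q x \<ge> 0" "\<pi>Y = density dx (\<lambda>x. ennreal (q x))"
           "prob_space \<pi>Y"
    and w: "\<forall>x. q x = 0 \<longrightarrow> p x = 0" "w = (\<lambda>x. p x / q x)" "bounded (range w)"
    and eps: "0 < \<epsilon>" "\<epsilon> < 1"
    and P_kernel: "P \<in> borel \<rightarrow>\<^sub>M prob_algebra borel"
    and P_stat: "\<forall>A\<in>sets borel. (\<integral>x. measure (P x) A \<partial>\<pi>) = measure \<pi> A"
    and M: "prob_space M"
    and meas: "\<forall>n. X n \<in> M \<rightarrow>\<^sub>M borel" "\<forall>n. Y n \<in> M \<rightarrow>\<^sub>M borel"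
              "\<forall>n. Z n \<in> M \<rightarrow>\<^sub>M count_space UNIV"
    and init: "\<forall>\<omega>\<in>space M. X 0 \<omega> = x0 \<and> Y 0 \<omega> = y0"
    and Y_aux: "\<forall>n h. h \<in> borel_measurable borel \<longrightarrow> bounded (range h) \<longrightarrow>
        (AE \<omega> in M. real_cond_exp M (F_alg M X Y n) (\<lambda>\<omega>. h (Y (Suc n) \<omega>)) \<omega>
                    = real_cond_exp M (G_alg M Y n) (\<lambda>\<omega>. h (Y (Suc n) \<omega>)) \<omega>)"
    and cond_indep: "\<forall>n g h. n \<ge> 1 \<longrightarrow> g \<in> borel_measurable borel \<longrightarrow> bounded (range g) \<longrightarrow>
        h \<in> borel_measurable borel \<longrightarrow> bounded (range h) \<longrightarrow>
        (AE \<omega> in M. real_cond_exp M (F_alg M X Y (n - 1)) (\<lambda>\<omega>. g (X n \<omega>) * h (Y n \<omega>)) \<omega>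
           = real_cond_exp M (F_alg M X Y (n - 1)) (\<lambda>\<omega>. g (X n \<omega>)) \<omega>
             * real_cond_exp M (F_alg M X Y (n - 1)) (\<lambda>\<omega>. h (Y n \<omega>)) \<omega>)"
    and Z_bern: "\<forall>n\<ge>1. prob_space.prob M {\<omega>\<in>space M. Z n \<omega>} = \<epsilon>"
    and Z_iid: "prob_space.indep_vars M (\<lambda>_. count_space UNIV) Z {1..}"
    and Z_indep: "\<forall>n\<ge>1. prob_space.indep_set M (events_of M (count_space UNIV) (Z n))
        (sigma_sets (space M) (F_gen M X Y (n - 1) \<union> (\<Union>k. events_of M borel (Y k))))"
    and X_step: "\<forall>n g. n \<ge> 1 \<longrightarrow> g \<in> borel_measurable borel \<longrightarrow> bounded (range g) \<longrightarrow>
        (AE \<omega> in M.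
           (Z n \<omega> \<longrightarrow> theta_defined w Y (n - 1) \<omega> \<longrightarrow>
              real_cond_exp M (H_alg M X Y Z n) (\<lambda>\<omega>. g (X n \<omega>)) \<omega> = theta_int w Y y0 (n - 1) \<omega> g)
         \<and> (\<not> Z n \<omega> \<longrightarrow>
              real_cond_exp M (H_alg M X Y Z n) (\<lambda>\<omega>. g (X n \<omega>)) \<omega> = (\<integral>y. g y \<partial>P (X (n - 1) \<omega>))))"
  shows "(\<forall>n. tv_dist (distr M borel (X n)) \<pi>
             \<le> (\<Sum>l=0..n. (1 - \<epsilon>) ^ (n - l) * Bseq M \<pi>Y Y w (int l - 1)))
       \<and> (\<forall>f n. f \<in> borel_measurable borel \<longrightarrow> bounded (range f) \<longrightarrow> n \<ge> 1 \<longrightarrow>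
             (\<integral>\<omega>. ((1 / sqrt (real n)) * (\<Sum>i=1..n. f (X i \<omega>) - (\<integral>x. f x \<partial>\<pi>)))^2 \<partial>M)
             \<le> 80 / \<epsilon>^2 * (supnorm f)^2 / real n + 64 / \<epsilon>^2 * (supnorm f)^2
               + (supnorm f)^2 * ((1 / sqrt (real n)) * (\<Sum>k=0..n-1. sqrt (Bseq M \<pi>Y Y w (int k))))^2)"
proof -
  interpret ir_mcmc M dx \<pi> \<pi>Y p q w P \<epsilon> x0 y0 X Y Z
    by (rule ir_mcmc.intro[OF M ir_mcmc_axioms.intro]) (fact assms)+
  show ?thesis
    using tv_dist_bound normalized_mean_square_bound by blast
qed

end
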